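(* There exists a constant $\kappa>0$, independent of the dimension, such that for every $n\ge1$ and every weight $w\in A_\infty$ on $\mathbb{R}^n$, the measure $w\,dx$ is doubling; that is, there is a constant $D_w$ with $$w(2Q)\le D_w\,w(Q)\quad\text{for every cube }Q,$$ where $$D_w\le\exp\left(\kappa\,n\,(4[w]_{A_\infty})^{1+2^{n+1}([w]_{A_\infty}-1)}\right).$$
   Context: Cubes $Q\subset\mathbb{R}^n$ have sides parallel to the coordinate axes; $2Q$ is the cube with the same center as $Q$ and twice its side length. A weight is a locally integrable function $w$ on $\mathbb{R}^n$ with $0<w(x)<\infty$ for a.e. $x$; $w(E)=\int_E w\,dx$. For $1<p<\infty$, $w\in A_p$ means $\sup_Q\left(\frac1{|Q|}\int_Q w\right)\left(\frac1{|Q|}\int_Q w^{1-p'}\right)^{p-1}<\infty$, $p'=p/(p-1)$; $w\in A_1$ means $\sup_Q\left(\frac1{|Q|}\int_Q w\right)\operatorname{ess\,sup}_Q (w^{-1})<\infty$. $A_\infty:=\bigcup_{p\ge1}A_p$; equivalently $w\in A_\infty$ iff the Fujii--Wilson constant $[w]_{A_\infty}:=\sup_Q\frac1{w(Q)}\int_Q M(w\chi_Q)\,dx$ is finite, where $Mf(x)=\sup_{Q\ni x}\frac1{|Q|}\int_Q|f|$ (supremum over cubes containing $x$). *)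

theory Defs
  imports "HOL-Analysis.Analysis" "HOL-Probability.Essential_Supremum"
begin

text \<open>
  The dimension is quantified inside the theorem (the constant must not depend on it), so the
  points of $n$-dimensional Euclidean space are extensional functions on \<open>{..<n}\<close> rather than
  vectors indexed by a type.  The completion makes measurability mean Lebesgue measurability.
\<close>

definition lebn :: "nat \<Rightarrow> (nat \<Rightarrow> real) measure" where
  "lebn n = completion (\<Pi>\<^sub>M i\<in>{..<n}. lborel)"

text \<open>The closed cube with center \<open>c\<close> and side length \<open>l\<close>; boundaries are null sets.\<close>

definition cube :: "nat \<Rightarrow> (nat \<Rightarrow> real) \<Rightarrow> real \<Rightarrow> (nat \<Rightarrow> real) set" where
  "cube n c l = (\<Pi>\<^sub>E i\<in>{..<n}. {c i - l / 2 .. c i + l / 2})"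

definition cubes :: "nat \<Rightarrow> (nat \<Rightarrow> real) set set" where
  "cubes n = {cube n c l |c l. c \<in> space (lebn n) \<and> 0 < l}"

definition locally_integrable :: "nat \<Rightarrow> ((nat \<Rightarrow> real) \<Rightarrow> real) \<Rightarrow> bool" where
  "locally_integrable n f \<longleftrightarrow> f \<in> borel_measurable (lebn n) \<and>
     (\<forall>K. compactin (powertop_real {..<n}) K \<longrightarrow> set_integrable (lebn n) K f)"

text \<open>Weights are real-valued, which loses only values on null sets; so \<open>w x < \<infinity>\<close> is automatic.\<close>

definition weight :: "nat \<Rightarrow> ((nat \<Rightarrow> real) \<Rightarrow> real) \<Rightarrow> bool" where
  "weight n w \<longleftrightarrow> locally_integrable n w \<and> (AE x in lebn n. 0 < w x)"

definition weight_measure :: "nat \<Rightarrow> ((nat \<Rightarrow> real) \<Rightarrow> real) \<Rightarrow> (nat \<Rightarrow> real) measure" where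
  "weight_measure n w = density (lebn n) (\<lambda>x. ennreal (w x))"

definition mean :: "nat \<Rightarrow> (nat \<Rightarrow> real) set \<Rightarrow> ((nat \<Rightarrow> real) \<Rightarrow> real) \<Rightarrow> ennreal" where
  "mean n Q f = (\<integral>\<^sup>+ x\<in>Q. ennreal \<bar>f x\<bar> \<partial>lebn n) / emeasure (lebn n) Q"

text \<open>Real powers of extended nonnegative reals; only used for exponents \<open>a > 0\<close>.\<close>

definition ennpowr :: "ennreal \<Rightarrow> real \<Rightarrow> ennreal" where
  "ennpowr x a = (if x = \<infinity> then \<infinity> else ennreal (enn2real x powr a))"

text \<open>
  The exponents \<open>p > 1\<close> and \<open>p = 1\<close>.  For a weight the product below never has the form \<open>0 * \<infinity>\<close>:
  both means are positive, and so is the essential supremum.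
\<close>

definition Ap_const :: "real \<Rightarrow> nat \<Rightarrow> ((nat \<Rightarrow> real) \<Rightarrow> real) \<Rightarrow> ennreal" where
  "Ap_const p n w =
     (SUP Q\<in>cubes n. mean n Q w * ennpowr (mean n Q (\<lambda>x. w x powr (1 - p / (p - 1)))) (p - 1))"

definition A1_const :: "nat \<Rightarrow> ((nat \<Rightarrow> real) \<Rightarrow> real) \<Rightarrow> ennreal" where
  "A1_const n w =
     (SUP Q\<in>cubes n. mean n Q w * esssup (restrict_space (lebn n) Q) (\<lambda>x. ennreal (inverse (w x))))"

definition A_class :: "real \<Rightarrow> nat \<Rightarrow> ((nat \<Rightarrow> real) \<Rightarrow> real) set" where
  "A_class p n = {w. weight n w \<and> (if p = 1 then A1_const n w else Ap_const p n w) < \<infinity>}"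

definition A_infinity :: "nat \<Rightarrow> ((nat \<Rightarrow> real) \<Rightarrow> real) set" where
  "A_infinity n = (\<Union>p\<in>{1..}. A_class p n)"

definition maximal :: "nat \<Rightarrow> ((nat \<Rightarrow> real) \<Rightarrow> real) \<Rightarrow> (nat \<Rightarrow> real) \<Rightarrow> ennreal" where
  "maximal n f x = (SUP Q\<in>{Q \<in> cubes n. x \<in> Q}. mean n Q f)"

text \<open>
  Finite on \<open>A_infinity\<close>.  The claimed bound fails for the junk value \<open>enn2real \<infinity> = 0\<close> (it would
  give doubling constant at most 1), so passing to the real value hides no case.
\<close>

definition fujii_wilson :: "nat \<Rightarrow> ((nat \<Rightarrow> real) \<Rightarrow> real) \<Rightarrow> ennreal" where
  "fujii_wilson n w =
     (SUP Q\<in>cubes n. (\<integral>\<^sup>+ x\<in>Q. maximal n (\<lambda>y. w y * indicator Q y) x \<partial>lebn n)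
                      / emeasure (weight_measure n w) Q)"

end

theory Submission
  imports Defs
begin

text \<open>
  Let \<open>R\<close> be a cube, \<open>v = w(R)\<close>, and let \<open>M\<close> be the dyadic maximal function of \<open>w\<close> inside \<open>R\<close>,
  truncated at a finite generation.  A stopping-time decomposition of \<open>{M > \<lambda>}\<close>, in which every
  stopping cube satisfies the Fujii--Wilson bound with \<open>W = [w]\<close>, gives for \<open>\<lambda>\<close> above the mean of \<open>w\<close>
  the inequality \<open>\<integral>(M - \<lambda>)\<^sup>+ \<le> (2\<^sup>nW - 1) \<lambda> |{M > \<lambda>}|\<close>.  Since \<open>\<integral>(M - \<lambda>)\<^sup>+\<close> is at most \<open>(W - 1) v\<close>
  when \<open>\<lambda>\<close> is the mean, doubling \<open>\<lambda>\<close> repeatedly makes this integral decay geometrically.  For a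
  set \<open>E\<close> of small cells \<open>w(E) \<le> \<integral>\<^sub>E M \<le> \<lambda>|E| + \<integral>(M - \<lambda>)\<^sup>+\<close>; so the outer layer of cells of
  generation \<open>N\<close> carries at most three quarters of \<open>v\<close> as soon as \<open>2\<^sup>N\<close> is about
  \<open>8n(4W) powr (2\<^bsup>n+1\<^esup>(W - 1))\<close>.  Peeling off \<open>2\<^bsup>N-1\<^esup>\<close> such layers halves the side of the cube.

  That the Fujii--Wilson constant of an \<open>A\<^sub>p\<close> weight is finite also has to be proved.  By Markov's
  inequality a subset of \<open>Q\<close> of proportional measure has proportional weight.  This yields
  \<open>\<integral>M \<le> C v\<close> by induction on the generation (stop when the mean has doubled), and it makes the
  measure doubling, which bounds the full maximal function by the dyadic one.
\<close>


subsection \<open>Half-open cells and their dyadic children\<close>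

text \<open>Half-open, so that the dyadic children partition a cell exactly; \<open>a\<close> is the
  lower corner, whereas \<open>cube\<close> is described by its center.\<close>

definition cell :: "nat \<Rightarrow> (nat \<Rightarrow> real) \<Rightarrow> real \<Rightarrow> (nat \<Rightarrow> real) set" where
  "cell n a s = (\<Pi>\<^sub>E i\<in>{..<n}. {a i..<a i + s})"

text \<open>Labels of the \<open>2 ^ n\<close> children: in each coordinate 0 chooses the lower half
  and 1 the upper half.\<close>

definition halves :: "nat \<Rightarrow> (nat \<Rightarrow> real) set" where
  "halves n = (\<Pi>\<^sub>E i\<in>{..<n}. {0, 1})"

definition corner :: "(nat \<Rightarrow> real) \<Rightarrow> real \<Rightarrow> (nat \<Rightarrow> real) \<Rightarrow> nat \<Rightarrow> real" where
  "corner a s e i = a i + e i * (s / 2)"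

lemma finite_halves: "finite (halves n)"
  by (auto simp: halves_def intro!: finite_PiE)

lemma space_lebn: "space (lebn n) = extensional {..<n}"
  by (auto simp: lebn_def space_PiM PiE_UNIV_domain PiE_def)

lemma sets_PiE_lebn:
  assumes "\<And>i. i < n \<Longrightarrow> A i \<in> sets borel"
  shows "(\<Pi>\<^sub>E i\<in>{..<n}. A i) \<in> sets (lebn n)"
  unfolding lebn_def using assms by (intro sets_completionI_sets sets_PiM_I_finite) auto

lemma emeasure_PiE_lebn:
  assumes "\<And>i. i < n \<Longrightarrow> A i \<in> sets borel"
  shows "emeasure (lebn n) (\<Pi>\<^sub>E i\<in>{..<n}. A i) = (\<Prod>i<n. emeasure lborel (A i))"
proof -
  interpret product_sigma_finite "\<lambda>_. lborel :: real measure" ..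
  have "(\<Pi>\<^sub>E i\<in>{..<n}. A i) \<in> sets (\<Pi>\<^sub>M i\<in>{..<n}. lborel)"
    using assms by (intro sets_PiM_I_finite) auto
  then have "emeasure (lebn n) (\<Pi>\<^sub>E i\<in>{..<n}. A i) =
      emeasure (\<Pi>\<^sub>M i\<in>{..<n}. lborel) (\<Pi>\<^sub>E i\<in>{..<n}. A i)"
    by (simp add: lebn_def)
  also have "\<dots> = (\<Prod>i<n. emeasure lborel (A i))"
    using assms by (intro emeasure_PiM) auto
  finally show ?thesis .
qed

lemma cell_in_sets [measurable]: "cell n a s \<in> sets (lebn n)"
  by (auto simp: cell_def intro!: sets_PiE_lebn)

lemma emeasure_cell: "0 \<le> s \<Longrightarrow> emeasure (lebn n) (cell n a s) = ennreal (s ^ n)"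
  by (simp add: cell_def emeasure_PiE_lebn ennreal_power)

lemma cube_in_sets [measurable]: "cube n c l \<in> sets (lebn n)"
  by (auto simp: cube_def intro!: sets_PiE_lebn)

lemma emeasure_cube: "0 \<le> l \<Longrightarrow> emeasure (lebn n) (cube n c l) = ennreal (l ^ n)"
  by (simp add: cube_def emeasure_PiE_lebn ennreal_power)

lemma mem_cell: "x \<in> cell n a s \<longleftrightarrow> x \<in> extensional {..<n} \<and> (\<forall>i<n. a i \<le> x i \<and> x i < a i + s)"
  by (auto simp: cell_def PiE_iff)

lemma mem_cube:
  "x \<in> cube n c l \<longleftrightarrow> x \<in> extensional {..<n} \<and> (\<forall>i<n. c i - l / 2 \<le> x i \<and> x i \<le> c i + l / 2)"
  by (auto simp: cube_def PiE_iff)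

text \<open>Comparing each coordinate of \<open>x\<close> with the midpoint determines the child
  that holds \<open>x\<close>. Covering, disjointness and inclusion of the children all follow from
  this.\<close>

lemma mem_half_cell_iff:
  assumes "0 < s" "e \<in> halves n"
  shows "x \<in> cell n (corner a s e) (s / 2) \<longleftrightarrow>
    x \<in> cell n a s \<and> e = (\<lambda>i\<in>{..<n}. if x i < a i + s / 2 then 0 else 1)"
proof -
  have e: "e \<in> extensional {..<n}" "\<And>i. i < n \<Longrightarrow> e i = 0 \<or> e i = 1"
    using assms by (auto simp: halves_def PiE_iff)
  have *: "a i + e i * (s / 2) \<le> x i \<and> x i < a i + e i * (s / 2) + s / 2 \<longleftrightarrow>
     (a i \<le> x i \<and> x i < a i + s) \<and> e i = (if x i < a i + s / 2 then 0 else 1)" if "i < n" for i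
    using e(2)[OF that] assms by auto
  have "e = (\<lambda>i\<in>{..<n}. if x i < a i + s / 2 then 0 else 1) \<longleftrightarrow>
     (\<forall>i<n. e i = (if x i < a i + s / 2 then 0 else 1))"
  proof
    assume "\<forall>i<n. e i = (if x i < a i + s / 2 then 0 else 1)"
    then show "e = (\<lambda>i\<in>{..<n}. if x i < a i + s / 2 then 0 else 1)"
      using e(1) by (intro extensionalityI[where A = "{..<n}"]) auto
  qed auto
  moreover have "(\<forall>i<n. corner a s e i \<le> x i \<and> x i < corner a s e i + s / 2) \<longleftrightarrow>
     (\<forall>i<n. a i \<le> x i \<and> x i < a i + s) \<and>
     (\<forall>i<n. e i = (if x i < a i + s / 2 then 0 else 1))"
    unfolding corner_def using * by meson
  ultimately show ?thesis
    unfolding mem_cell by simp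
qed

lemma half_cell_subset:
  "0 < s \<Longrightarrow> e \<in> halves n \<Longrightarrow> cell n (corner a s e) (s / 2) \<subseteq> cell n a s"
  using mem_half_cell_iff by blast

lemma ex_half_cell:
  assumes "0 < s" "x \<in> cell n a s"
  shows "\<exists>e\<in>halves n. x \<in> cell n (corner a s e) (s / 2)"
proof
  let ?e = "\<lambda>i\<in>{..<n}. if x i < a i + s / 2 then 0 else (1::real)"
  show e: "?e \<in> halves n"
    by (auto simp: halves_def)
  show "x \<in> cell n (corner a s ?e) (s / 2)"
    unfolding mem_half_cell_iff[OF assms(1) e] using assms(2) by simp
qed

lemma indicator_cell_halves:
  assumes "0 < s"
  shows "(indicator (cell n a s) x :: ennreal) =
    (\<Sum>e\<in>halves n. indicator (cell n (corner a s e) (s / 2)) x)"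
proof (cases "x \<in> cell n a s")
  case True
  define e0 where "e0 = (\<lambda>i\<in>{..<n}. if x i < a i + s / 2 then 0 else (1::real))"
  have e0: "e0 \<in> halves n"
    by (auto simp: e0_def halves_def)
  have "(\<Sum>e\<in>halves n. indicator (cell n (corner a s e) (s / 2)) x) =
      (\<Sum>e\<in>halves n. if e = e0 then 1 else (0::ennreal))"
    using assms True by (intro sum.cong) (auto simp: mem_half_cell_iff indicator_def e0_def)
  also have "\<dots> = 1"
    using e0 finite_halves by simp
  finally show ?thesis
    using True by simp
next
  case False
  then show ?thesis
    using assms by (auto simp: indicator_def mem_half_cell_iff intro!: sum.neutral)
qed

lemma sum_half_cells:
  assumes "0 < s" "e \<in> halves n" "x \<in> cell n (corner a s e) (s / 2)"
  shows "(\<Sum>e\<in>halves n. f e * indicator (cell n (corner a s e) (s / 2)) x) = (f e :: ennreal)"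
proof -
  have "(\<Sum>e'\<in>halves n. f e' * indicator (cell n (corner a s e') (s / 2)) x) =
      (\<Sum>e'\<in>halves n. if e' = e then f e' else 0)"
    using assms by (intro sum.cong) (auto simp: mem_half_cell_iff indicator_def)
  also have "\<dots> = f e"
    using assms finite_halves by simp
  finally show ?thesis .
qed

lemma nn_integral_halves:
  assumes "sets M = sets (lebn n)" "f \<in> borel_measurable M" "0 < s"
  shows "(\<integral>\<^sup>+x\<in>cell n a s. f x \<partial>M) =
    (\<Sum>e\<in>halves n. \<integral>\<^sup>+x\<in>cell n (corner a s e) (s / 2). f x \<partial>M)"
proof -
  have [measurable]: "f \<in> borel_measurable M" "\<And>b t. cell n b t \<in> sets M"
    using assms by auto
  show ?thesis
    unfolding indicator_cell_halves[OF assms(3)] sum_distrib_left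
    by (intro nn_integral_sum) measurable
qed

subsection \<open>The dyadic maximal function\<close>

text \<open>The stopping-time arguments see the weight only through its mass, so they are carried
  out for any measure that is finite on cells.\<close>

locale cell_measure =
  fixes n :: nat and \<nu> :: "(nat \<Rightarrow> real) measure"
  assumes sets_eq: "sets \<nu> = sets (lebn n)"
    and finite_cell: "emeasure \<nu> (cell n a s) < \<infinity>"
begin

definition avg :: "(nat \<Rightarrow> real) \<Rightarrow> real \<Rightarrow> ennreal" where
  "avg a s = emeasure \<nu> (cell n a s) / ennreal (s ^ n)"

text \<open>On the cell this is the maximum of the averages over the dyadic cells of generations 0
  to \<open>N\<close> that contain \<open>x\<close>: at most one summand is nonzero. Outside the
  cell the value is \<open>avg a s\<close>, so integrals are always restricted to the cell.\<close>

primrec dmax :: "nat \<Rightarrow> (nat \<Rightarrow> real) \<Rightarrow> real \<Rightarrow> (nat \<Rightarrow> real) \<Rightarrow> ennreal" where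
  "dmax 0 = (\<lambda>a s x. avg a s)"
| "dmax (Suc N) = (\<lambda>a s x. max (avg a s)
     (\<Sum>e\<in>halves n. dmax N (corner a s e) (s / 2) x * indicator (cell n (corner a s e) (s / 2)) x))"

lemma measurable_eq: "borel_measurable \<nu> = borel_measurable (lebn n)"
  by (rule measurable_cong_sets) (auto simp: sets_eq)

lemma cell_in_sets' [measurable]: "cell n a s \<in> sets \<nu>"
  by (simp add: sets_eq)

lemma dmax_measurable [measurable]: "dmax N a s \<in> borel_measurable (lebn n)"
proof (induction N arbitrary: a s)
  case (Suc N)
  have [measurable]: "dmax N b t \<in> borel_measurable (lebn n)" for b t
    by (rule Suc)
  show ?case
    by simp
qed simp

lemma dmax_measurable' [measurable]: "dmax N a s \<in> borel_measurable \<nu>"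
  by (simp add: measurable_eq)

lemma avg_times: "0 < s \<Longrightarrow> avg a s * ennreal (s ^ n) = emeasure \<nu> (cell n a s)"
  by (simp add: avg_def ennreal_divide_times mult_divide_eq_ennreal)

lemma avg_le_iff: "0 < s \<Longrightarrow> avg a s \<le> l \<longleftrightarrow> emeasure \<nu> (cell n a s) \<le> l * ennreal (s ^ n)"
  by (metis avg_times avg_def divide_right_mono_ennreal mult_right_mono mult_divide_eq_ennreal ennreal_neq_top
      zero_le zero_less_power ennreal_less_zero_iff less_irrefl)

lemma avg_le_dmax: "avg a s \<le> dmax N a s x"
  by (cases N) auto

lemma dmax_Suc:
  assumes "0 < s" "e \<in> halves n" "x \<in> cell n (corner a s e) (s / 2)"
  shows "dmax (Suc N) a s x = max (avg a s) (dmax N (corner a s e) (s / 2) x)"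
  using sum_half_cells[OF assms] by simp

lemma dmax_mono: "dmax N a s x \<le> dmax (Suc N) a s x"
proof (induction N arbitrary: a s x)
  case (Suc N)
  show ?case
    by (subst (1 2) dmax.simps) (intro max.mono sum_mono mult_right_mono Suc, auto)
qed simp

text \<open>The last hypothesis says that \<open>g\<close> cannot see the average of the whole cell,
  so only the children matter. It holds for truncations and level-set indicators at a level not
  below that average, and gives the induction steps below; \<open>M\<close> is Lebesgue measure or
  \<nu>.\<close>

lemma nn_integral_dmax_Suc:
  assumes "sets M = sets (lebn n)" "g \<in> borel_measurable borel" "0 < s"
    and "\<And>y. g (max (avg a s) y) = g y"
  shows "(\<integral>\<^sup>+x\<in>cell n a s. g (dmax (Suc N) a s x) \<partial>M) =
    (\<Sum>e\<in>halves n. \<integral>\<^sup>+x\<in>cell n (corner a s e) (s / 2). g (dmax N (corner a s e) (s / 2) x) \<partial>M)"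
proof -
  have [measurable]: "g \<in> borel_measurable borel" "dmax N b t \<in> borel_measurable M" for N b t
    using assms by (simp_all add: measurable_cong_sets[OF assms(1) refl])
  have "(\<integral>\<^sup>+x\<in>cell n a s. g (dmax (Suc N) a s x) \<partial>M) =
    (\<Sum>e\<in>halves n. \<integral>\<^sup>+x\<in>cell n (corner a s e) (s / 2). g (dmax (Suc N) a s x) \<partial>M)"
    by (rule nn_integral_halves[OF assms(1) _ assms(3)]) measurable
  also have "\<dots> = (\<Sum>e\<in>halves n. \<integral>\<^sup>+x\<in>cell n (corner a s e) (s / 2).
      g (dmax N (corner a s e) (s / 2) x) \<partial>M)"
    using dmax_Suc[OF assms(3)] assms(4)
    by (intro sum.cong nn_integral_cong refl) (auto simp: indicator_def simp del: dmax.simps)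
  finally show ?thesis .
qed

lemma nn_integral_dmax_gt:
  assumes "sets M = sets (lebn n)" "l < avg a s"
  shows "(\<integral>\<^sup>+x\<in>cell n a s. indicator {l<..} (dmax N a s x) \<partial>M) = emeasure M (cell n a s)"
proof -
  have "(\<integral>\<^sup>+x\<in>cell n a s. indicator {l<..} (dmax N a s x) \<partial>M) = (\<integral>\<^sup>+x. indicator (cell n a s) x \<partial>M)"
    using assms(2) avg_le_dmax[of a s N]
    by (intro nn_integral_cong) (auto simp: indicator_def dest: less_le_trans)
  then show ?thesis
    using assms(1) by simp
qed

section \<open>Stopping-time estimates at a fixed level\<close>

lemma emeasure_half_cell_le:
  assumes "0 < s" "e \<in> halves n"
  shows "emeasure \<nu> (cell n (corner a s e) (s / 2)) \<le> emeasure \<nu> (cell n a s)"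
  using half_cell_subset[OF assms] by (intro emeasure_mono) auto

text \<open>Descend until an average first exceeds \<open>l\<close>. On such a stopping cell the
  truncation at \<open>l\<close> has no effect and the assumed bound for the remaining generations
  applies; off the stopping cells the integrand is \<open>l\<close>. As the whole cell does not
  stop, fewer than \<open>N\<close> generations remain, which lets the lemma serve inside an
  induction on \<open>N\<close>.\<close>

lemma nn_integral_max_dmax_le:
  assumes "\<And>b t m. 0 < t \<Longrightarrow> m < N \<Longrightarrow>
      (\<integral>\<^sup>+x\<in>cell n b t. dmax m b t x \<partial>lebn n) \<le> K * emeasure \<nu> (cell n b t)"
    and "0 < s" "avg a s \<le> l"
  shows "(\<integral>\<^sup>+x\<in>cell n a s. max (dmax N a s x) l \<partial>lebn n) \<le>
    (\<integral>\<^sup>+x\<in>cell n a s. l * indicator {..l} (dmax N a s x) \<partial>lebn n) +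
    K * (\<integral>\<^sup>+x\<in>cell n a s. indicator {l<..} (dmax N a s x) \<partial>\<nu>)"
  using assms
proof (induction N arbitrary: a s)
  case 0
  then show ?case
    by (auto simp: max_def intro!: nn_integral_mono)
next
  case (Suc N)
  have *: "(\<integral>\<^sup>+x\<in>cell n b t. max (dmax N b t x) l \<partial>lebn n) \<le>
    (\<integral>\<^sup>+x\<in>cell n b t. l * indicator {..l} (dmax N b t x) \<partial>lebn n) +
    K * (\<integral>\<^sup>+x\<in>cell n b t. indicator {l<..} (dmax N b t x) \<partial>\<nu>)" if "0 < t" for b t
  proof (cases "avg b t \<le> l")
    case True
    then show ?thesis
      using that Suc.prems(1) by (intro Suc.IH) auto
  next
    case False
    then have l: "l < avg b t" by simp
    have "max (dmax N b t x) l = dmax N b t x" for x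
      using less_le_trans[OF l avg_le_dmax[of b t N x]] by simp
    then have "(\<integral>\<^sup>+x\<in>cell n b t. max (dmax N b t x) l \<partial>lebn n) = (\<integral>\<^sup>+x\<in>cell n b t. dmax N b t x \<partial>lebn n)"
      by simp
    also have "\<dots> \<le> K * emeasure \<nu> (cell n b t)"
      using Suc.prems(1) that by simp
    finally show ?thesis
      using l by (simp add: nn_integral_dmax_gt sets_eq add_increasing)
  qed
  have m: "max (max (avg a s) y) l = max y l" "l * indicator {..l} (max (avg a s) y) = l * indicator {..l} y"
    "indicator {l<..} (max (avg a s) y) = (indicator {l<..} y :: ennreal)" for y
    using Suc.prems(3) by (auto simp: indicator_def max_def)
  show ?case
    using Suc.prems(2) *
    by (subst (1 2 3) nn_integral_dmax_Suc)
      (auto simp only: m sets_eq sum_distrib_left sum.distrib[symmetric] intro!: sum_mono, auto)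
qed

text \<open>The parent of a stopping cell still has average at most \<open>l\<close> and has
  \<open>2 ^ n\<close> times its volume. So the mass of a stopping cell is at most
  \<open>2 ^ n * l\<close> times its volume, and these bounds add up.\<close>

lemma emeasure_dmax_gt_le:
  assumes "0 < s" "avg a s \<le> l"
  shows "(\<integral>\<^sup>+x\<in>cell n a s. indicator {l<..} (dmax N a s x) \<partial>\<nu>) \<le>
    2 ^ n * l * (\<integral>\<^sup>+x\<in>cell n a s. indicator {l<..} (dmax N a s x) \<partial>lebn n)"
  using assms
proof (induction N arbitrary: a s)
  case 0
  then have "\<not> l < avg a s" by simp
  then show ?case by (simp add: indicator_def)
next
  case (Suc N)
  have m: "indicator {l<..} (max (avg a s) y) = (indicator {l<..} y :: ennreal)" for y
    using Suc.prems(2) by (auto simp: indicator_def max_def)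
  have *: "(\<integral>\<^sup>+x\<in>cell n b t. indicator {l<..} (dmax N b t x) \<partial>\<nu>) \<le>
    2 ^ n * l * (\<integral>\<^sup>+x\<in>cell n b t. indicator {l<..} (dmax N b t x) \<partial>lebn n)"
    if "e \<in> halves n" "b = corner a s e" "t = s / 2" for b t e
  proof (cases "avg b t \<le> l")
    case True
    then show ?thesis
      using that Suc.prems(1) by (intro Suc.IH) auto
  next
    case False
    have "emeasure \<nu> (cell n b t) \<le> emeasure \<nu> (cell n a s)"
      unfolding that(2,3) using Suc.prems(1) that(1) by (rule emeasure_half_cell_le)
    also have "\<dots> \<le> l * ennreal (s ^ n)"
      using Suc.prems by (simp add: avg_le_iff)
    also have "s ^ n = 2 ^ n * t ^ n"
      by (simp add: that(3) power_divide)
    also have "ennreal \<dots> = 2 ^ n * emeasure (lebn n) (cell n b t)"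
      using that Suc.prems by (simp add: emeasure_cell ennreal_mult flip: ennreal_power)
    finally have "emeasure \<nu> (cell n b t) \<le> 2 ^ n * l * emeasure (lebn n) (cell n b t)"
      by (simp add: ac_simps)
    then show ?thesis
      using False by (simp add: nn_integral_dmax_gt sets_eq)
  qed
  show ?case
    using Suc.prems *
    by (subst (1 2) nn_integral_dmax_Suc)
      (auto simp only: m sets_eq sum_distrib_left intro!: sum_mono, auto)
qed

text \<open>Weak-type (1,1) inequality with constant 1: the superlevel set is a disjoint union of
  cells whose averages exceed \<open>l\<close>.\<close>

lemma emeasure_dmax_gt_ge:
  assumes "0 < s"
  shows "l * (\<integral>\<^sup>+x\<in>cell n a s. indicator {l<..} (dmax N a s x) \<partial>lebn n) \<le>
    (\<integral>\<^sup>+x\<in>cell n a s. indicator {l<..} (dmax N a s x) \<partial>\<nu>)"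
proof -
  have large: "l * (\<integral>\<^sup>+x\<in>cell n b t. indicator {l<..} (dmax m b t x) \<partial>lebn n) \<le>
      (\<integral>\<^sup>+x\<in>cell n b t. indicator {l<..} (dmax m b t x) \<partial>\<nu>)" if "0 < t" "l < avg b t" for b t m
  proof -
    have "l * ennreal (t ^ n) \<le> avg b t * ennreal (t ^ n)"
      using that by (intro mult_right_mono) auto
    then show ?thesis
      using that by (simp add: nn_integral_dmax_gt sets_eq emeasure_cell avg_times)
  qed
  show ?thesis
    using assms
  proof (induction N arbitrary: a s)
    case 0
    then show ?case
      using large[of s a 0] by (cases "l < avg a s") (auto simp: indicator_def)
  next
    case (Suc N)
    show ?case
    proof (cases "l < avg a s")
      case False
      then have m: "indicator {l<..} (max (avg a s) y) = (indicator {l<..} y :: ennreal)" for y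
        by (auto simp: indicator_def max_def)
      show ?thesis
        using Suc.prems Suc.IH
        by (subst (1 2) nn_integral_dmax_Suc)
          (auto simp only: m sets_eq sum_distrib_left intro!: sum_mono, auto)
    qed (use large Suc.prems in blast)
  qed
qed

text \<open>Within the cell, \<open>E\<close> is a union of its dyadic descendants of generation \<open>N\<close>.\<close>

definition saturated :: "nat \<Rightarrow> (nat \<Rightarrow> real) \<Rightarrow> real \<Rightarrow> (nat \<Rightarrow> real) set \<Rightarrow> bool" where
  "saturated N a s E \<longleftrightarrow> (\<forall>x\<in>cell n a s. \<forall>y\<in>cell n a s.
     (\<forall>i<n. \<lfloor>(x i - a i) * 2 ^ N / s\<rfloor> = \<lfloor>(y i - a i) * 2 ^ N / s\<rfloor>) \<longrightarrow> x \<in> E \<longrightarrow> y \<in> E)"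

text \<open>Passing to a child shifts each rescaled coordinate by an integer, 0 or
  \<open>2 ^ N\<close>, so the floors that index the descendants shift by the same amount.\<close>

lemma saturated_half:
  assumes "saturated (Suc N) a s E" "0 < s" "e \<in> halves n"
  shows "saturated N (corner a s e) (s / 2) E"
proof -
  have "\<exists>k::int. \<forall>z. (z - corner a s e i) * 2 ^ N / (s / 2) = (z - a i) * 2 ^ Suc N / s - of_int k"
    if "i < n" for i
  proof -
    have "e i = of_int 0 \<or> e i = of_int 1"
      using assms(3) that by (auto simp: halves_def PiE_iff)
    then obtain k :: int where k: "e i = of_int k" by blast
    have "(z - corner a s e i) * 2 ^ N / (s / 2) = (z - a i) * 2 ^ Suc N / s - of_int (k * 2 ^ N)" for z
      using assms(2) by (simp add: corner_def k field_simps)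
    then show ?thesis by blast
  qed
  then obtain k :: "nat \<Rightarrow> int" where k: "\<And>i z. i < n \<Longrightarrow>
      (z - corner a s e i) * 2 ^ N / (s / 2) = (z - a i) * 2 ^ Suc N / s - of_int (k i)"
    by metis
  show ?thesis
    unfolding saturated_def
  proof (intro ballI impI)
    fix x y
    assume xy: "x \<in> cell n (corner a s e) (s / 2)" "y \<in> cell n (corner a s e) (s / 2)" "x \<in> E"
      and *: "\<forall>i<n. \<lfloor>(x i - corner a s e i) * 2 ^ N / (s / 2)\<rfloor> =
        \<lfloor>(y i - corner a s e i) * 2 ^ N / (s / 2)\<rfloor>"
    have "\<lfloor>(x i - a i) * 2 ^ Suc N / s\<rfloor> = \<lfloor>(y i - a i) * 2 ^ Suc N / s\<rfloor>" if "i < n" for i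
      using *[rule_format, OF that] unfolding k[OF that] floor_diff_of_int by simp
    moreover have "x \<in> cell n a s" "y \<in> cell n a s"
      using xy half_cell_subset[OF assms(2,3)] by auto
    ultimately show "y \<in> E"
      using assms(1) xy(3) unfolding saturated_def by blast
  qed
qed

text \<open>On every dyadic cell of generation \<open>N\<close> the function \<open>dmax N\<close>
  is at least the average there, so its integral is at least the mass. A saturated \<open>E\<close>
  consists of whole cells of this kind.\<close>

lemma emeasure_le_nn_integral_dmax:
  assumes "0 < s" "saturated N a s E" and E: "E \<in> sets (lebn n)"
  shows "emeasure \<nu> (E \<inter> cell n a s) \<le> (\<integral>\<^sup>+x\<in>cell n a s. dmax N a s x * indicator E x \<partial>lebn n)"
  using assms(1,2)
proof (induction N arbitrary: a s)
  case 0
  \<comment> \<open>At generation 0 all points of the cell have the same index, so a saturated set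
    contains the cell or misses it.\<close>
  have "\<lfloor>(x i - a i) * 2 ^ 0 / s\<rfloor> = 0" if "x \<in> cell n a s" "i < n" for x i
    using that 0(1) by (auto simp: mem_cell floor_eq_iff field_simps)
  then consider "E \<inter> cell n a s = {}" | "cell n a s \<subseteq> E"
    using 0(2) unfolding saturated_def by fastforce
  then show ?case
  proof cases
    case 2
    then have "(\<integral>\<^sup>+x\<in>cell n a s. dmax 0 a s x * indicator E x \<partial>lebn n) =
        (\<integral>\<^sup>+x. avg a s * indicator (cell n a s) x \<partial>lebn n)"
      by (intro nn_integral_cong) (auto simp: indicator_def)
    also have "\<dots> = emeasure \<nu> (cell n a s)"
      using 0(1) by (simp add: nn_integral_cmult_indicator emeasure_cell avg_times)
    finally show ?thesis
      using 2 by (simp add: Int_absorb1)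
  qed simp
next
  case (Suc N)
  have [measurable]: "E \<in> sets (lebn n)" "E \<in> sets \<nu>"
    using E by (auto simp: sets_eq)
  let ?C = "\<lambda>e. cell n (corner a s e) (s / 2)"
  have "emeasure \<nu> (E \<inter> cell n a s) = (\<integral>\<^sup>+x\<in>cell n a s. indicator E x \<partial>\<nu>)"
    by (simp add: indicator_inter_arith[symmetric] flip: nn_integral_indicator)
  also have "\<dots> = (\<Sum>e\<in>halves n. \<integral>\<^sup>+x\<in>?C e. indicator E x \<partial>\<nu>)"
    using Suc.prems by (intro nn_integral_halves) (auto simp: sets_eq)
  also have "\<dots> = (\<Sum>e\<in>halves n. emeasure \<nu> (E \<inter> ?C e))"
    by (simp add: indicator_inter_arith[symmetric] flip: nn_integral_indicator)
  also have "\<dots> \<le> (\<Sum>e\<in>halves n. \<integral>\<^sup>+x\<in>?C e. dmax N (corner a s e) (s / 2) x * indicator E x \<partial>lebn n)"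
    using Suc.prems by (intro sum_mono Suc.IH saturated_half) auto
  also have "\<dots> \<le> (\<Sum>e\<in>halves n. \<integral>\<^sup>+x\<in>?C e. dmax (Suc N) a s x * indicator E x \<partial>lebn n)"
    using dmax_Suc[OF Suc.prems(1)]
    by (intro sum_mono nn_integral_mono) (auto simp: indicator_def simp del: dmax.simps)
  also have "\<dots> = (\<integral>\<^sup>+x\<in>cell n a s. dmax (Suc N) a s x * indicator E x \<partial>lebn n)"
    using Suc.prems by (intro nn_integral_halves[symmetric]) (auto simp del: dmax.simps)
  finally show ?case .
qed

end

subsection \<open>Geometric decay and the choice of parameters\<close>

text \<open>Convexity: the graph of \<open>2 powr x\<close> over the unit interval lies below its
  chord. This converts the decay factor \<open>1 + 1 / (2 * A)\<close> into a power of two.\<close>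

lemma two_powr_le: assumes "0 \<le> x" "x \<le> 1" shows "2 powr x \<le> 1 + (x::real)"
proof -
  have "exp ((1 - x) *\<^sub>R 0 + x *\<^sub>R ln 2) \<le> (1 - x) * exp 0 + x * exp (ln (2::real))"
    using assms by (intro convex_onD[OF exp_convex]) auto
  then show ?thesis by (simp add: powr_def)
qed

text \<open>This trades the exponent \<open>W\<close> from the decay estimate for the \<open>W - 1\<close> of the theorem.\<close>

lemma W_ln_le:
  assumes "3 / 2 \<le> (W::real)"
  shows "W * ln (2 * (W - 1)) \<le> (W - 1) * ln (4 * W)"
proof -
  define u where "u = W - 1"
  have u: "1 / 2 \<le> u" "W = u + 1"
    using assms by (auto simp: u_def)
  \<comment> \<open>Since \<open>4 * W = (2 * u) * (2 * (1 + 1 / u))\<close>, both sides of the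
    claim contain \<open>u * ln (2 * u)\<close>; this is what remains after cancelling it.\<close>
  have "ln (2 * u) \<le> u * ln (2 * (1 + 1 / u))"
  proof (cases "u \<le> 1")
    case True
    have "ln (2 * u) \<le> ln 2"
      using True u by simp
    also have "\<dots> \<le> u * ln 4"
      using u ln_realpow[of "2::real" 2] mult_right_mono[of "1/2" u "ln 4"] by simp
    also have "\<dots> \<le> u * ln (2 * (1 + 1 / u))"
      using True u by (intro mult_left_mono) (auto simp: field_simps)
    finally show ?thesis .
  next
    case False
    \<comment> \<open>For \<open>u > 1\<close> the inequality is the sum of
      \<open>ln u \<le> u * ln 2\<close>, from a tangent line of the logarithm, and
      \<open>ln 2 \<le> u * ln (1 + 1 / u)\<close>, from \<open>two_powr_le\<close>.\<close>
    have "ln (u / 2) \<le> u / 2 - 1"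
      using False by (intro ln_le_minus_one) auto
    moreover have "u * (1 / 2) \<le> u * ln 2"
      using False ln2_ge_two_thirds by (intro mult_left_mono) linarith+
    moreover have "ln (u / 2) = ln u - ln 2"
      using False by (simp add: ln_div)
    ultimately have 1: "ln u \<le> u * ln 2"
      using ln_2_less_1 by linarith
    have "ln (2 powr (1 / u)) \<le> ln (1 + 1 / u)"
      using False by (intro ln_mono two_powr_le) auto
    then have "ln 2 \<le> u * ln (1 + 1 / u)"
      using False by (simp add: ln_powr field_simps)
    moreover have "ln (2 * (1 + 1 / u)) = ln 2 + ln (1 + 1 / u)" "ln (2 * u) = ln 2 + ln u"
      using False by (rule_tac ln_mult_pos; auto intro!: add_pos_pos)+
    ultimately show ?thesis
      using 1 by (simp only: distrib_left)
  qed
  moreover have "4 * W = (2 * u) * (2 * (1 + 1 / u))"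
    using u by (simp add: field_simps)
  moreover have "ln ((2 * u) * (2 * (1 + 1 / u))) = ln (2 * u) + ln (2 * (1 + 1 / u))"
    using u by (intro ln_mult_pos) (auto intro!: add_pos_pos)
  moreover have "W * ln (2 * (W - 1)) = u * ln (2 * u) + ln (2 * u)"
    by (simp add: u_def algebra_simps)
  ultimately show ?thesis
    by (simp only: u_def[symmetric] distrib_left)
qed

text \<open>\<open>k\<close> counts the doublings of the level after which the decay has brought the
  tail below half the mass; \<open>N\<close> is the generation at which the outer layer is thin
  enough for that level. The last bound is the cost of \<open>2 ^ (N - 1)\<close> peelings at a
  factor 4 each.\<close>

lemma ex_iteration_parameters:
  fixes W :: real
  assumes "1 \<le> W" "1 \<le> n"
  shows "\<exists>k N. 8 * real n * 2 ^ k \<le> 2 ^ N \<and> 2 * (W - 1) \<le> (1 + 1 / (2 * (2 ^ n * W - 1))) ^ k \<and>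
    (4::real) ^ (2 ^ (N - 1)) \<le> exp (32 * real n * (4 * W) powr (1 + 2 ^ (n + 1) * (W - 1)))"
proof -
  define A where "A = 2 ^ n * W - 1"
  have "(2::real) ^ 1 \<le> 2 ^ n"
    using assms(2) by (intro power_increasing) auto
  then have "2 * 1 \<le> 2 ^ n * W"
    using assms(1) by (intro mult_mono) auto
  then have A: "1 \<le> A" by (simp add: A_def)
  have "\<exists>k. 2 * (W - 1) \<le> (1 + 1 / (2 * A)) ^ k \<and> 2 ^ k \<le> 2 * (4 * W) powr (2 ^ (n + 1) * (W - 1))"
  proof (cases "W \<le> 3 / 2")
    case True
    have "1 \<le> (4 * W) powr (2 ^ (n + 1) * (W - 1))"
      using assms by (intro ge_one_powr_ge_zero) auto
    then show ?thesis
      using True by (intro exI[of _ 0]) auto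
  next
    case False
    define B where "B = 2 * (W - 1)"
    \<comment> \<open>\<open>two_powr_le\<close> gives
      \<open>2 \<le> (1 + 1 / (2 * A)) powr (2 * A)\<close>, so each factor 2 in \<open>B\<close>
      costs \<open>2 * A\<close> doublings; rounding up costs a factor 2 in
      \<open>2 ^ k\<close>.\<close>
    define k where "k = nat \<lceil>2 * A * log 2 B\<rceil>"
    have B: "1 \<le> B" using False by (simp add: B_def)
    have k: "2 * A * log 2 B \<le> real k" "real k \<le> 2 * A * log 2 B + 1"
      using A B by (auto simp: k_def of_nat_nat ceiling_correct)
    have "B = 2 powr (log 2 B)" using B by simp
    also have "\<dots> \<le> 2 powr (1 / (2 * A) * real k)"
      using k(1) A by (intro powr_mono) (auto simp: field_simps)
    also have "\<dots> = (2 powr (1 / (2 * A))) ^ k"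
      by (subst powr_powr[symmetric]) (simp add: powr_realpow)
    also have "\<dots> \<le> (1 + 1 / (2 * A)) ^ k"
      using A by (intro power_mono two_powr_le) auto
    finally have 1: "B \<le> (1 + 1 / (2 * A)) ^ k" .
    have "(2::real) ^ k = 2 powr real k"
      by (simp add: powr_realpow)
    also have "\<dots> \<le> 2 powr (1 + log 2 B * (2 * A))"
      using k(2) by (intro powr_mono) (auto simp: algebra_simps)
    also have "\<dots> = 2 * (2 powr log 2 B) powr (2 * A)"
      by (simp only: powr_add powr_powr[symmetric]) simp
    also have "\<dots> = 2 * B powr (2 * A)"
      using B by simp
    \<comment> \<open>\<open>2 * A\<close> is \<open>2 ^ (n + 1) * W - 2\<close>; the larger
      exponent is the one to which \<open>W_ln_le\<close>, multiplied by \<open>2 ^ (n + 1)\<close>,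
      applies.\<close>
    also have "\<dots> \<le> 2 * B powr (2 ^ (n + 1) * W)"
      using B by (intro mult_left_mono powr_mono) (auto simp: A_def)
    also have "B powr (2 ^ (n + 1) * W) \<le> (4 * W) powr (2 ^ (n + 1) * (W - 1))"
      using False W_ln_le[of W] mult_left_mono[of "W * ln B" "(W - 1) * ln (4 * W)" "2 ^ (n + 1)"]
      by (simp add: powr_def B_def algebra_simps)
    finally show ?thesis
      using 1 by (auto simp: B_def)
  qed
  then obtain k where k: "2 * (W - 1) \<le> (1 + 1 / (2 * A)) ^ k"
    "2 ^ k \<le> 2 * (4 * W) powr (2 ^ (n + 1) * (W - 1))" by blast
  \<comment> \<open>\<open>2 ^ m\<close> is the least power of two at or above \<open>n\<close>,
    hence at most \<open>2 * n\<close>.\<close>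
  define m where "m = (LEAST m. n \<le> 2 ^ m)"
  have "n \<le> 2 ^ n" by (simp add: less_imp_le)
  then have m: "n \<le> 2 ^ m" unfolding m_def by (rule LeastI)
  have m2: "2 ^ m \<le> 2 * n"
  proof (cases m)
    case (Suc j)
    then have "\<not> n \<le> 2 ^ j"
      unfolding m_def by (intro not_less_Least) simp
    then show ?thesis by (simp add: Suc)
  qed (use assms in simp)
  \<comment> \<open>The 3 supplies the factor 8 demanded of \<open>2 ^ N\<close>.\<close>
  define N where "N = 3 + m + k"
  have "real n \<le> 2 ^ m" using m by (metis of_nat_le_iff of_nat_numeral of_nat_power)
  then have "8 * real n * 2 ^ k \<le> 2 ^ N"
    by (simp add: N_def power_add)
  moreover have "(4::real) ^ (2 ^ (N - 1)) = exp (ln 4 * 2 ^ (N - 1))"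
    by (metis exp_ln exp_of_nat2_mult mult.commute of_nat_numeral of_nat_power zero_less_numeral)
  moreover have "ln 4 * 2 ^ (N - 1) \<le> 32 * real n * (4 * W) powr (1 + 2 ^ (n + 1) * (W - 1))"
  proof -
    have "ln (4::real) * 2 ^ (N - 1) = ln 4 * (4 * 2 ^ m * 2 ^ k)"
      by (simp add: N_def power_add)
    \<comment> \<open>Origin of 32: \<open>ln 4 \<le> 2\<close>, the factor 4 left from the 3 in
      \<open>N - 1\<close>, a 2 from rounding \<open>n\<close> up to \<open>2 ^ m\<close>, and a 2
      from rounding up \<open>k\<close>.\<close>
    also have "\<dots> \<le> 2 * (4 * (2 * real n) * (2 * (4 * W) powr (2 ^ (n + 1) * (W - 1))))"
    proof (intro mult_mono)
      show "ln (4::real) \<le> 2"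
        using ln_realpow[of "2::real" 2] ln_2_less_1 by simp
      show "2 ^ m \<le> 2 * real n"
        using m2 by (metis of_nat_le_iff of_nat_mult of_nat_numeral of_nat_power)
    qed (use k in auto)
    also have "\<dots> = 32 * real n * (4 * W) powr (2 ^ (n + 1) * (W - 1))"
      by simp
    also have "\<dots> \<le> 32 * real n * (4 * W) powr (1 + 2 ^ (n + 1) * (W - 1))"
      using assms by (intro mult_left_mono powr_mono) auto
    finally show ?thesis .
  qed
  ultimately show ?thesis
    using k(1) unfolding A_def by (intro exI[of _ k] exI[of _ N]) auto
qed

section \<open>Decay of the truncated integral under doubling of the level, and the mass of the
  outer layer\<close>

context cell_measure begin

text \<open>Let \<open>H k\<close> integrate the maximum of \<open>dmax\<close> and the level
  \<open>l k\<close>. The excess \<open>H k - 2 ^ k * v\<close> is the integral of the positive part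
  of \<open>dmax - l k\<close>; using the maximum avoids subtraction in \<open>ennreal\<close>. At
  the mean the excess is at most \<open>(W - 1) * v\<close> by \<open>bound\<close>, and
  \<open>H2\<close> with \<open>H3\<close> shrinks it by the factor \<open>1 + 1 / (2 * A)\<close>
  at every doubling.\<close>

lemma nn_integral_max_dmax_decay:
  assumes bound: "\<And>b t m. 0 < t \<Longrightarrow>
      (\<integral>\<^sup>+x\<in>cell n b t. dmax m b t x \<partial>lebn n) \<le> ennreal W * emeasure \<nu> (cell n b t)"
    and W: "1 \<le> W" and n: "1 \<le> n" and s: "0 < s"
    and v: "emeasure \<nu> (cell n a s) = ennreal v" "0 \<le> v"
  shows "(\<integral>\<^sup>+x\<in>cell n a s. max (dmax N a s x) (ennreal (2 ^ k * (v / s ^ n))) \<partial>lebn n)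
     \<le> ennreal (2 ^ k * v + (W - 1) * v / (1 + 1 / (2 * (2 ^ n * W - 1))) ^ k)"
proof -
  define A where "A = 2 ^ n * W - 1"
  have "(2::real) ^ 1 \<le> 2 ^ n"
    using n by (intro power_increasing) auto
  then have "2 * 1 \<le> 2 ^ n * W"
    using W by (intro mult_mono) auto
  then have A: "1 \<le> A" by (simp add: A_def)
  define V where "V = s ^ n"
  have V: "0 < V" using s by (simp add: V_def)
  define l where "l k = 2 ^ k * (v / V)" for k
  have l: "0 \<le> l k" "l k * V = 2 ^ k * v" "l (Suc k) = l k + l k" for k
    using v(2) V by (auto simp: l_def)
  have avg: "avg a s = ennreal (l 0)"
    using v V by (simp add: avg_def l_def V_def divide_ennreal)
  have avg_le: "avg a s \<le> ennreal (l k)" for k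
  proof -
    have "1 * (v / V) \<le> 2 ^ k * (v / V)"
      using v(2) V by (intro mult_right_mono) auto
    then show ?thesis
      unfolding avg by (intro ennreal_leI) (simp add: l_def)
  qed
  define H where "H k = (\<integral>\<^sup>+x\<in>cell n a s. max (dmax N a s x) (ennreal (l k)) \<partial>lebn n)" for k
  define F where "F k = measure (lebn n) {x \<in> cell n a s. ennreal (l k) < dmax N a s x}" for k
  have cellV: "emeasure (lebn n) (cell n a s) = ennreal V"
    using s by (simp add: emeasure_cell V_def)
  have meas: "{x \<in> cell n a s. c < dmax N a s x} \<in> sets (lebn n)"
     "{x \<in> cell n a s. dmax N a s x \<le> c} \<in> sets (lebn n)" for c
  proof -
    have "{x \<in> cell n a s. P x} = cell n a s \<inter> {x \<in> space (lebn n). P x}" for P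
      using sets.sets_into_space[OF cell_in_sets] by blast
    then show "{x \<in> cell n a s. c < dmax N a s x} \<in> sets (lebn n)"
      "{x \<in> cell n a s. dmax N a s x \<le> c} \<in> sets (lebn n)"
      by simp_all
  qed
  have fin: "emeasure (lebn n) {x \<in> cell n a s. P x} \<noteq> top" for P
  proof -
    have "emeasure (lebn n) {x \<in> cell n a s. P x} \<le> emeasure (lebn n) (cell n a s)"
      by (intro emeasure_mono) auto
    also have "\<dots> < top" by (simp add: cellV)
    finally show ?thesis by simp
  qed
  have F: "0 \<le> F k" "F k \<le> V" "emeasure (lebn n) {x \<in> cell n a s. ennreal (l k) < dmax N a s x} = ennreal (F k)"
    "emeasure (lebn n) {x \<in> cell n a s. dmax N a s x \<le> ennreal (l k)} = ennreal (V - F k)" for k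
  proof -
    let ?S = "{x \<in> cell n a s. ennreal (l k) < dmax N a s x}"
    show F1: "emeasure (lebn n) ?S = ennreal (F k)"
      unfolding F_def by (rule emeasure_eq_ennreal_measure) (rule fin)
    show F0: "0 \<le> F k" by (simp add: F_def)
    have "emeasure (lebn n) ?S \<le> ennreal V"
      unfolding cellV[symmetric] by (intro emeasure_mono) auto
    then show F2: "F k \<le> V" using F0 V by (simp add: F1)
    have "{x \<in> cell n a s. dmax N a s x \<le> ennreal (l k)} = cell n a s - ?S" by auto
    then show "emeasure (lebn n) {x \<in> cell n a s. dmax N a s x \<le> ennreal (l k)} = ennreal (V - F k)"
      using fin F0 F2 meas by (simp add: emeasure_Diff cellV F1 ennreal_minus)
  qed
  have int_le: "(\<integral>\<^sup>+x\<in>cell n a s. c * indicator {..ennreal (l k)} (dmax N a s x) \<partial>lebn n) = c * ennreal (V - F k)" for c k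
  proof -
    have "(\<integral>\<^sup>+x\<in>cell n a s. c * indicator {..ennreal (l k)} (dmax N a s x) \<partial>lebn n) =
      (\<integral>\<^sup>+x. c * indicator {x \<in> cell n a s. dmax N a s x \<le> ennreal (l k)} x \<partial>lebn n)"
      by (intro nn_integral_cong) (auto simp: indicator_def)
    then show ?thesis
      using meas by (simp add: nn_integral_cmult_indicator F)
  qed
  have int_gt: "(\<integral>\<^sup>+x\<in>cell n a s. indicator {ennreal (l k)<..} (dmax N a s x) \<partial>lebn n) = ennreal (F k)" for k
  proof -
    have "(\<integral>\<^sup>+x\<in>cell n a s. indicator {ennreal (l k)<..} (dmax N a s x) \<partial>lebn n) =
      (\<integral>\<^sup>+x. indicator {x \<in> cell n a s. ennreal (l k) < dmax N a s x} x \<partial>lebn n)"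
      by (intro nn_integral_cong) (auto simp: indicator_def)
    then show ?thesis
      using meas by (simp add: F)
  qed
  \<comment> \<open>Stop at level \<open>l k\<close>: the stopping cells have mass at most
    \<open>2 ^ n * l k * F k\<close> and integral at most \<open>W\<close> times this; the remaining
    volume contributes \<open>l k * (V - F k)\<close>. Collecting \<open>F k\<close> leaves the
    coefficient \<open>A\<close>.\<close>
  have H2: "H k \<le> ennreal (2 ^ k * v + A * l k * F k)" for k
  proof -
    have "H k \<le> ennreal (l k) * ennreal (V - F k) +
        ennreal W * (\<integral>\<^sup>+x\<in>cell n a s. indicator {ennreal (l k)<..} (dmax N a s x) \<partial>\<nu>)"
      unfolding H_def int_le[symmetric] using s avg_le bound by (intro nn_integral_max_dmax_le) auto
    also have "\<dots> \<le> ennreal (l k) * ennreal (V - F k) + ennreal W * (2 ^ n * ennreal (l k) * ennreal (F k))"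
      unfolding int_gt[symmetric] using s avg_le by (intro add_mono mult_left_mono emeasure_dmax_gt_le) auto
    also have "\<dots> = ennreal (l k * (V - F k) + W * (2 ^ n * l k * F k))"
      using l F W by (simp add: ennreal_mult ennreal_plus flip: ennreal_power)
    also have "l k * (V - F k) + W * (2 ^ n * l k * F k) = l k * V + A * l k * F k"
      by (simp add: A_def algebra_simps)
    finally show ?thesis by (simp add: l(2))
  qed
  \<comment> \<open>Doubling the level raises the maximum by at most \<open>l k\<close>, and only
    where \<open>dmax\<close> is at most \<open>l (Suc k)\<close>, a set of volume
    \<open>V - F (Suc k)\<close>.\<close>
  have H3: "H (Suc k) \<le> H k + ennreal (l k * (V - F (Suc k)))" for k
  proof -
    have pt: "max y (ennreal (l (Suc k))) \<le>
        max y (ennreal (l k)) + ennreal (l k) * indicator {..ennreal (l (Suc k))} y" for y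
    proof (cases "y \<le> ennreal (l (Suc k))")
      case True
      have "ennreal (l (Suc k)) = ennreal (l k) + ennreal (l k)"
        using l(1) by (simp only: l(3) ennreal_plus)
      also have "\<dots> \<le> max y (ennreal (l k)) + ennreal (l k)"
        by (intro add_right_mono) simp
      finally show ?thesis
        using True by (simp add: max_absorb2)
    next
      case False
      then show ?thesis
        by (simp add: max_absorb1 indicator_def)
    qed
    have "H (Suc k) \<le> (\<integral>\<^sup>+x\<in>cell n a s. max (dmax N a s x) (ennreal (l k)) +
        ennreal (l k) * indicator {..ennreal (l (Suc k))} (dmax N a s x) \<partial>lebn n)"
      unfolding H_def by (intro nn_integral_mono mult_right_mono pt) simp
    also have "\<dots> = H k + (\<integral>\<^sup>+x\<in>cell n a s. ennreal (l k) * indicator {..ennreal (l (Suc k))} (dmax N a s x) \<partial>lebn n)"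
      unfolding H_def distrib_right by (intro nn_integral_add) measurable
    also have "\<dots> = H k + ennreal (l k * (V - F (Suc k)))"
      unfolding int_le using l(1) F(2)[of "Suc k"] by (simp add: ennreal_mult)
    finally show ?thesis .
  qed
  have "H k \<le> ennreal (2 ^ k * v + (W - 1) * v / (1 + 1 / (2 * A)) ^ k)"
  proof (induction k)
    case 0
    have "max (dmax N a s x) (avg a s) = dmax N a s x" for x
      using avg_le_dmax by (simp add: max_absorb1)
    then have "H 0 = (\<integral>\<^sup>+x\<in>cell n a s. dmax N a s x \<partial>lebn n)"
      unfolding H_def avg[symmetric] by simp
    also have "\<dots> \<le> ennreal (W * v)"
      using bound[OF s, where b = a and m = N] W v by (simp add: ennreal_mult)
    finally show ?case by (simp add: algebra_simps)
  next
    case (Suc k)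
    define h where "h k = enn2real (H k)" for k
    have h: "H k = ennreal (h k)" "0 \<le> h k" for k
      unfolding h_def using le_less_trans[OF H2[of k] ennreal_less_top] by simp_all
    define \<rho> where "\<rho> = 1 + 1 / (2 * A)"
    have \<rho>: "0 < \<rho>" using A by (simp add: \<rho>_def add_pos_nonneg)
    have nn: "0 \<le> 2 ^ k * v + (W - 1) * v / \<rho> ^ k" for k
      using v W \<rho> by simp
    have i1: "h k \<le> 2 ^ k * v + (W - 1) * v / \<rho> ^ k"
      using Suc nn by (simp add: h \<rho>_def)
    have i2: "h (Suc k) \<le> 2 ^ Suc k * v + A * l (Suc k) * F (Suc k)"
    proof -
      have "0 \<le> 2 ^ Suc k * v + A * l (Suc k) * F (Suc k)"
        using A F(1)[of "Suc k"] l(1)[of "Suc k"] v(2)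
        by (intro add_nonneg_nonneg mult_nonneg_nonneg) auto
      then show ?thesis
        using H2[of "Suc k"] unfolding h by (simp only: ennreal_le_iff)
    qed
    have i3: "h (Suc k) \<le> h k + l k * (V - F (Suc k))"
    proof -
      have "0 \<le> l k * (V - F (Suc k))"
        using F(2)[of "Suc k"] l(1)[of k] by simp
      then show ?thesis
        using H3[of k] h(2)[of k] unfolding h
        by (simp only: ennreal_plus[symmetric] ennreal_le_iff add_nonneg_nonneg)
    qed
    \<comment> \<open>\<open>l (Suc k) = 2 * l k\<close> turns \<open>i2\<close> into a lower bound
      for \<open>l k * F (Suc k)\<close>, which is the saving over \<open>l k * V\<close> in
      \<open>i3\<close>.\<close>
    have "(h (Suc k) - 2 ^ Suc k * v) / (2 * A) \<le> l k * F (Suc k)"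
      using i2 A by (simp add: l(3) field_simps)
    then have "(h (Suc k) - 2 ^ Suc k * v) * \<rho> \<le> h k - 2 ^ k * v"
    proof -
      have "(h (Suc k) - 2 ^ Suc k * v) * \<rho> =
          (h (Suc k) - 2 ^ Suc k * v) + (h (Suc k) - 2 ^ Suc k * v) / (2 * A)"
        by (simp only: \<rho>_def distrib_left) simp
      moreover have "l k * (V - F (Suc k)) = 2 ^ k * v - l k * F (Suc k)"
        by (simp add: l(2) right_diff_distrib)
      moreover have "2 ^ Suc k * v = 2 * (2 ^ k * v)"
        by simp
      ultimately show ?thesis
        using i3 \<open>_ / (2 * A) \<le> l k * F (Suc k)\<close> by linarith
    qed
    also have "\<dots> \<le> (W - 1) * v / \<rho> ^ k"
      using i1 by simp
    finally have "h (Suc k) - 2 ^ Suc k * v \<le> (W - 1) * v / \<rho> ^ Suc k"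
      using \<rho> by (simp add: field_simps)
    then show ?case
      unfolding h \<rho>_def by (intro ennreal_leI) simp
  qed
  then show ?thesis
    unfolding H_def A_def l_def V_def .
qed

text \<open>Let \<open>v\<close> be the mass of the cell and \<open>I\<close> the inner cell. The
  mass of the outer layer plus \<open>l\<close> times the volume of \<open>I\<close> is at most the
  truncated integral, hence at most \<open>2 ^ k * v + v / 2\<close>. As \<open>I\<close> has nearly
  full volume, its term is at least \<open>2 ^ k * v - v / 4\<close>. So the layer carries at most
  three quarters of \<open>v\<close>.\<close>

lemma emeasure_inner_cell:
  assumes bound: "\<And>b t m. 0 < t \<Longrightarrow>
      (\<integral>\<^sup>+x\<in>cell n b t. dmax m b t x \<partial>lebn n) \<le> ennreal W * emeasure \<nu> (cell n b t)"
    and W: "1 \<le> W" and n: "1 \<le> n" and s: "0 < s"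
    and N: "8 * real n * 2 ^ k \<le> 2 ^ N"
    and k: "2 * (W - 1) \<le> (1 + 1 / (2 * (2 ^ n * W - 1))) ^ k"
  shows "emeasure \<nu> (cell n a s) \<le> 4 * emeasure \<nu> (cell n (\<lambda>i. a i + s / 2 ^ N) (s - 2 * (s / 2 ^ N)))"
proof -
  define \<delta> where "\<delta> = s / 2 ^ N"
  define I where "I = cell n (\<lambda>i. a i + \<delta>) (s - 2 * \<delta>)"
  define l where "l = 2 ^ k * (measure \<nu> (cell n a s) / s ^ n)"
  let ?v = "measure \<nu> (cell n a s)"
  have [measurable]: "I \<in> sets (lebn n)" "I \<in> sets \<nu>"
    by (auto simp: I_def)
  have fin: "emeasure \<nu> (cell n b t) = ennreal (measure \<nu> (cell n b t))" for b t
    using finite_cell by (intro emeasure_eq_ennreal_measure) (simp add: less_top)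
  have "8 * 1 * 1 \<le> 8 * real n * 2 ^ k"
    using n by (intro mult_mono) auto
  with N have N8: "8 \<le> (2::real) ^ N" by linarith
  have \<delta>: "0 < \<delta>" "2 * \<delta> \<le> s" "\<delta> / s = 1 / 2 ^ N"
    using N8 s by (auto simp: \<delta>_def field_simps)
  have sub: "I \<subseteq> cell n a s"
  proof
    fix x assume x: "x \<in> I"
    then have "a i \<le> x i \<and> x i < a i + s" if "i < n" for i
      using that \<delta>(1) by (fastforce simp: I_def mem_cell dest!: spec[of _ i])
    with x show "x \<in> cell n a s"
      by (simp add: I_def mem_cell)
  qed
  have sat: "saturated N a s (space (lebn n) - I)"
    unfolding saturated_def
  proof (intro ballI impI)
    fix x y
    assume xy: "x \<in> cell n a s" "y \<in> cell n a s" "x \<in> space (lebn n) - I"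
      and eq: "\<forall>i<n. \<lfloor>(x i - a i) * 2 ^ N / s\<rfloor> = \<lfloor>(y i - a i) * 2 ^ N / s\<rfloor>"
    \<comment> \<open>The inner cell consists of the grid indices from 1 to \<open>2 ^ N - 2\<close>
      in each coordinate; half-openness makes both ends exact.\<close>
    have *: "a i + \<delta> \<le> z \<and> z < a i + \<delta> + (s - 2 * \<delta>) \<longleftrightarrow>
      1 \<le> \<lfloor>(z - a i) * 2 ^ N / s\<rfloor> \<and> \<lfloor>(z - a i) * 2 ^ N / s\<rfloor> < 2 ^ N - 1" for z i
    proof -
      have "a i + \<delta> \<le> z \<longleftrightarrow> 1 \<le> (z - a i) * 2 ^ N / s"
        using s by (simp add: \<delta>_def field_simps)
      moreover have "z < a i + \<delta> + (s - 2 * \<delta>) \<longleftrightarrow> (z - a i) * 2 ^ N < (s - \<delta>) * 2 ^ N"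
        by (subst mult_less_cancel_right_pos) auto
      moreover have "(s - \<delta>) * 2 ^ N = (2 ^ N - 1) * s"
        by (simp add: \<delta>_def left_diff_distrib)
      ultimately have "(a i + \<delta> \<le> z \<longleftrightarrow> 1 \<le> (z - a i) * 2 ^ N / s) \<and>
          (z < a i + \<delta> + (s - 2 * \<delta>) \<longleftrightarrow> (z - a i) * 2 ^ N / s < real_of_int (2 ^ N - 1))"
        using s by (simp add: pos_divide_less_eq)
      then show ?thesis
        unfolding floor_less_iff le_floor_iff by simp
    qed
    have "x \<in> I \<longleftrightarrow> y \<in> I"
      using eq xy(1,2) unfolding I_def mem_cell * by auto
    then show "y \<in> space (lebn n) - I"
      using xy sets.sets_into_space[OF cell_in_sets] by blast
  qed
  define \<rho> where "\<rho> = 1 + 1 / (2 * (2 ^ n * W - 1))"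
  have \<rho>: "0 < \<rho>"
  proof -
    have "1 * 1 \<le> 2 ^ n * W"
      using W by (intro mult_mono) auto
    then show ?thesis by (simp add: \<rho>_def add_pos_nonneg)
  qed
  have cell_I: "(space (lebn n) - I) \<inter> cell n a s = cell n a s - I"
    using sets.sets_into_space[OF cell_in_sets] by blast
  \<comment> \<open>\<open>dmax\<close> is integrated over the layer and the constant
    \<open>l\<close> over \<open>I\<close>; each is below the maximum of the two.\<close>
  have "emeasure \<nu> (cell n a s - I) + ennreal l * emeasure (lebn n) I \<le>
      (\<integral>\<^sup>+x\<in>cell n a s. dmax N a s x * indicator (space (lebn n) - I) x \<partial>lebn n) +
      (\<integral>\<^sup>+x. ennreal l * indicator I x \<partial>lebn n)"
    using emeasure_le_nn_integral_dmax[OF s sat] cell_I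
    by (intro add_mono) (auto simp: nn_integral_cmult_indicator)
  also have "\<dots> = (\<integral>\<^sup>+x. dmax N a s x * indicator (space (lebn n) - I) x * indicator (cell n a s) x +
       ennreal l * indicator I x \<partial>lebn n)"
    by (intro nn_integral_add[symmetric]) measurable
  also have "\<dots> \<le> (\<integral>\<^sup>+x\<in>cell n a s. max (dmax N a s x) (ennreal l) \<partial>lebn n)"
    using sub by (intro nn_integral_mono) (auto simp: indicator_def)
  also have "\<dots> \<le> ennreal (2 ^ k * ?v + (W - 1) * ?v / (1 + 1 / (2 * (2 ^ n * W - 1))) ^ k)"
    unfolding l_def by (intro nn_integral_max_dmax_decay bound W n s fin) auto
  finally have 1: "emeasure \<nu> (cell n a s - I) + ennreal l * emeasure (lebn n) I \<le> \<dots>" .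
  have "emeasure \<nu> (cell n a s - I) = ennreal (?v - measure \<nu> I)"
    using sub finite_cell[of "\<lambda>i. a i + \<delta>" "s - 2 * \<delta>"]
    by (simp add: emeasure_Diff fin I_def ennreal_minus sets_eq)
  with 1 have 2: "(?v - measure \<nu> I) + l * (s - 2 * \<delta>) ^ n \<le>
      2 ^ k * ?v + (W - 1) * ?v / (1 + 1 / (2 * (2 ^ n * W - 1))) ^ k"
  proof -
    have "measure \<nu> I \<le> ?v"
    proof -
      have "ennreal (measure \<nu> I) \<le> ennreal ?v"
        unfolding I_def fin[symmetric] using sub unfolding I_def by (intro emeasure_mono) auto
      then show ?thesis by simp
    qed
    moreover have l0: "0 \<le> l"
      using s by (simp add: l_def)
    moreover have "0 \<le> l * (s - 2 * \<delta>) ^ n"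
      using \<delta>(2) l0 by simp
    moreover have "0 \<le> 2 ^ k * ?v + (W - 1) * ?v / \<rho> ^ k"
      using W \<rho> by simp
    moreover have "ennreal l * emeasure (lebn n) I = ennreal (l * (s - 2 * \<delta>) ^ n)"
      using \<delta>(2) l0 by (simp add: I_def emeasure_cell ennreal_mult)
    ultimately show ?thesis
      using 1 unfolding \<open>emeasure \<nu> (cell n a s - I) = _\<close> \<rho>_def[symmetric]
      by (simp only: ennreal_plus[symmetric] ennreal_le_iff diff_ge_0_iff_ge)
  qed
  have "(W - 1) / \<rho> ^ k \<le> 1 / 2"
    using k[folded \<rho>_def] \<rho> by (simp add: pos_divide_le_eq)
  from mult_right_mono[OF this, of ?v]
  have 3: "(W - 1) * ?v / (1 + 1 / (2 * (2 ^ n * W - 1))) ^ k \<le> ?v / 2"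
    unfolding \<rho>_def[symmetric] by simp
  \<comment> \<open>Bernoulli bounds the relative volume of \<open>I\<close> from below; the choice
    of \<open>N\<close> makes the loss \<open>2 ^ k * (2 * n / 2 ^ N)\<close> at most one
    quarter.\<close>
  have *: "1 - n * (2 / 2 ^ N) \<le> (1 - 2 / 2 ^ N) ^ n"
  proof -
    have "- 1 \<le> - (2 / 2 ^ N :: real)"
      using N8 by simp
    from Bernoulli_inequality[OF this, of n] show ?thesis by simp
  qed
  have 4: "l * (s - 2 * \<delta>) ^ n \<ge> 2 ^ k * ?v - ?v / 4"
  proof -
    have "s - 2 * \<delta> = s * (1 - 2 / 2 ^ N)"
      by (simp add: \<delta>_def algebra_simps)
    then have "l * (s - 2 * \<delta>) ^ n = 2 ^ k * ?v * (1 - 2 / 2 ^ N) ^ n"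
      using s by (simp add: l_def power_mult_distrib)
    also have "\<dots> \<ge> 2 ^ k * ?v * (1 - n * (2 / 2 ^ N))"
      using * by (intro mult_left_mono) auto
    finally have "2 ^ k * ?v - (8 * real n * 2 ^ k / 2 ^ N) * (?v / 4) \<le> l * (s - 2 * \<delta>) ^ n"
      by (simp add: algebra_simps)
    moreover have "(8 * real n * 2 ^ k / 2 ^ N) * (?v / 4) \<le> 1 * (?v / 4)"
      using N by (intro mult_right_mono) auto
    ultimately show ?thesis by linarith
  qed
  have "?v \<le> 4 * measure \<nu> I"
    using 2 3 4 by linarith
  then have "ennreal ?v \<le> ennreal (4 * measure \<nu> I)"
    by (rule ennreal_leI)
  also have "\<dots> = 4 * ennreal (measure \<nu> I)"
    by (simp add: ennreal_mult)
  finally show ?thesis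
    unfolding I_def \<delta>_def fin .
qed

end

section \<open>Doubling by repeated peeling\<close>

lemma power_one_minus_inverse_le_half:
  assumes "1 \<le> J"
  shows "(1 - 1 / real J) ^ J \<le> 1 / 2"
proof -
  have "(1 - 1 / real J) ^ J \<le> exp (- (1 / real J)) ^ J"
    using assms exp_ge_add_one_self[of "- (1 / real J)"] by (intro power_mono) auto
  also have "\<dots> = exp (- 1)"
    using assms by (simp flip: exp_of_nat_mult)
  also have "\<dots> = 1 / exp 1"
    by (simp add: exp_minus inverse_eq_divide)
  also have "\<dots> \<le> 1 / 2"
    using exp_ge_add_one_self[of 1] by (intro divide_left_mono) auto
  finally show ?thesis .
qed

lemma centered_cell_mono:
  assumes "r \<le> l"
  shows "cell n (\<lambda>i. c i - r / 2) r \<subseteq> cell n (\<lambda>i. c i - l / 2) l"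
proof
  fix x assume x: "x \<in> cell n (\<lambda>i. c i - r / 2) r"
  have "c i - l / 2 \<le> x i \<and> x i < c i - l / 2 + l" if "i < n" for i
  proof -
    have "c i - r / 2 \<le> x i" "x i < c i - r / 2 + r"
      using x that by (auto simp: mem_cell)
    then show ?thesis using assms by linarith
  qed
  then show "x \<in> cell n (\<lambda>i. c i - l / 2) l"
    using x by (simp add: mem_cell)
qed

context cell_measure begin

text \<open>One peeling keeps the center, multiplies the side by \<open>1 - 1 / 2 ^ (N - 1)\<close>
  and costs a factor 4. After \<open>2 ^ (N - 1)\<close> peelings the side is at most half of what
  it was.\<close>

lemma emeasure_cell_doubling:
  assumes bound: "\<And>b t m. 0 < t \<Longrightarrow>
      (\<integral>\<^sup>+x\<in>cell n b t. dmax m b t x \<partial>lebn n) \<le> ennreal W * emeasure \<nu> (cell n b t)"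
    and W: "1 \<le> W" and n: "1 \<le> n" and l: "0 < l"
    and N: "8 * real n * 2 ^ k \<le> 2 ^ N"
    and k: "2 * (W - 1) \<le> (1 + 1 / (2 * (2 ^ n * W - 1))) ^ k"
  shows "emeasure \<nu> (cell n (\<lambda>i. c i - 2 * l / 2) (2 * l)) \<le>
    4 ^ 2 ^ (N - 1) * emeasure \<nu> (cell n (\<lambda>i. c i - l / 2) l)"
proof -
  define q where "q = 1 - 2 / (2::real) ^ N"
  let ?C = "\<lambda>r. cell n (\<lambda>i. c i - r / 2) r"
  have "8 * 1 * 1 \<le> 8 * real n * 2 ^ k"
    using n by (intro mult_mono) auto
  with N have N8: "8 \<le> (2::real) ^ N" by linarith
  then have q: "0 < q" by (simp add: q_def)
  from N8 have "N \<noteq> 0" by (intro notI) simp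
  then obtain M where M: "N = Suc M" by (cases N) auto
  have step: "emeasure \<nu> (?C r) \<le> 4 * emeasure \<nu> (?C (q * r))" if "0 < r" for r
  proof -
    have eq: "c i - r / 2 + r / 2 ^ N = c i - q * r / 2" "r - 2 * (r / 2 ^ N) = q * r" for i
      by (simp_all add: q_def field_simps)
    show ?thesis
      using emeasure_inner_cell[OF bound W n that N k, of "\<lambda>i. c i - r / 2"] unfolding eq .
  qed
  have "emeasure \<nu> (?C (2 * l)) \<le> 4 ^ j * emeasure \<nu> (?C (q ^ j * (2 * l)))" for j
  proof (induction j)
    case (Suc j)
    have "4 ^ j * emeasure \<nu> (?C (q ^ j * (2 * l))) \<le> 4 ^ j * (4 * emeasure \<nu> (?C (q * (q ^ j * (2 * l)))))"
      using l q by (intro mult_left_mono step) auto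
    with Suc show ?case
      by (simp add: ac_simps)
  qed simp
  also have "emeasure \<nu> (?C (q ^ (2 ^ M) * (2 * l))) \<le> emeasure \<nu> (?C l)"
  proof (intro emeasure_mono)
    have "q ^ (2 ^ M) \<le> 1 / 2"
      using power_one_minus_inverse_le_half[of "2 ^ M"] by (simp add: q_def M)
    then have "q ^ (2 ^ M) * (2 * l) \<le> 1 / 2 * (2 * l)"
      using l by (intro mult_right_mono) auto
    then show "?C (q ^ (2 ^ M) * (2 * l)) \<subseteq> ?C l"
      by (intro centered_cell_mono) simp
  qed simp
  finally show ?thesis
    by (simp add: M mult_left_mono)
qed

text \<open>Stop at twice the mean. By the weak-type inequality the stopping set \<open>S\<close>
  has at most half the volume, so \<open>sub\<close> applied to its complement gives
  \<open>v \<le> C * (v - \<nu>(S))\<close> for the mass \<open>v\<close>. With the induction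
  hypothesis on the stopping cells the integral is at most
  \<open>2 * v + 2 * C * \<nu>(S) \<le> 2 * C * v\<close>: the constant \<open>2 * C\<close>
  reproduces itself.\<close>

lemma nn_integral_dmax_le:
  assumes sub: "\<And>b t E. 0 < t \<Longrightarrow> E \<in> sets (lebn n) \<Longrightarrow> E \<subseteq> cell n b t \<Longrightarrow>
      emeasure (lebn n) (cell n b t) \<le> 2 * emeasure (lebn n) E \<Longrightarrow>
      emeasure \<nu> (cell n b t) \<le> ennreal C * emeasure \<nu> E"
    and C: "0 \<le> C" and s: "0 < s"
  shows "(\<integral>\<^sup>+x\<in>cell n a s. dmax N a s x \<partial>lebn n) \<le> ennreal (2 * C) * emeasure \<nu> (cell n a s)"
  using s
proof (induction N arbitrary: a s rule: less_induct)
  case (less N)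
  let ?R = "cell n a s" and ?v = "measure \<nu> (cell n a s)" and ?V = "s ^ n"
  define l where "l = 2 * (?v / ?V)"
  have V: "0 < ?V" using less.prems by simp
  have "0 \<le> ?v / ?V" using V by (intro divide_nonneg_pos measure_nonneg)
  then have l0: "0 \<le> l" "?v / ?V \<le> l" unfolding l_def by linarith+
  have fin: "emeasure \<nu> (cell n b t) = ennreal (measure \<nu> (cell n b t))" for b t
    using finite_cell by (intro emeasure_eq_ennreal_measure) (simp add: less_top)
  have avg: "avg a s = ennreal (?v / ?V)"
    using V by (simp add: avg_def fin divide_ennreal)
  define S where "S = {x \<in> ?R. ennreal l < dmax N a s x}"
  have S: "S \<subseteq> ?R" by (auto simp: S_def)
  have "S = ?R \<inter> {x \<in> space (lebn n). ennreal l < dmax N a s x}"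
    using sets.sets_into_space[OF cell_in_sets] by (auto simp: S_def)
  then have S_meas [measurable]: "S \<in> sets (lebn n)" "S \<in> sets \<nu>"
    by (auto simp: sets_eq)
  have S_int: "(\<integral>\<^sup>+x\<in>?R. indicator {ennreal l<..} (dmax N a s x) \<partial>M) = emeasure M S" if "S \<in> sets M" for M
  proof -
    have "(\<integral>\<^sup>+x\<in>?R. indicator {ennreal l<..} (dmax N a s x) \<partial>M) = (\<integral>\<^sup>+x. indicator S x \<partial>M)"
      by (intro nn_integral_cong) (auto simp: S_def indicator_def)
    then show ?thesis using that by simp
  qed
  have S_fin: "emeasure \<nu> S = ennreal (measure \<nu> S)" "emeasure (lebn n) S = ennreal (measure (lebn n) S)"
  proof -
    have "emeasure \<nu> S \<le> emeasure \<nu> ?R" "emeasure (lebn n) S \<le> emeasure (lebn n) ?R"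
      using S by (auto intro!: emeasure_mono)
    then have "emeasure \<nu> S < top" "emeasure (lebn n) S < top"
      using finite_cell[of a s] less.prems by (auto simp: emeasure_cell intro: le_less_trans)
    then show "emeasure \<nu> S = ennreal (measure \<nu> S)" "emeasure (lebn n) S = ennreal (measure (lebn n) S)"
      by (auto intro!: emeasure_eq_ennreal_measure)
  qed
  have Sv: "measure \<nu> S \<le> ?v"
  proof -
    have "ennreal (measure \<nu> S) \<le> ennreal ?v"
      unfolding S_fin[symmetric] fin[symmetric] using S by (intro emeasure_mono) auto
    then show ?thesis by simp
  qed
  have "(\<integral>\<^sup>+x\<in>?R. dmax N a s x \<partial>lebn n) \<le> (\<integral>\<^sup>+x\<in>?R. max (dmax N a s x) (ennreal l) \<partial>lebn n)"
    by (intro nn_integral_mono mult_right_mono) auto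
  also have "\<dots> \<le> (\<integral>\<^sup>+x\<in>?R. ennreal l * indicator {..ennreal l} (dmax N a s x) \<partial>lebn n) +
    ennreal (2 * C) * (\<integral>\<^sup>+x\<in>?R. indicator {ennreal l<..} (dmax N a s x) \<partial>\<nu>)"
    using less l0(2) by (intro nn_integral_max_dmax_le) (auto simp: avg intro!: ennreal_leI)
  also have "(\<integral>\<^sup>+x\<in>?R. ennreal l * indicator {..ennreal l} (dmax N a s x) \<partial>lebn n) \<le>
     (\<integral>\<^sup>+x. ennreal l * indicator ?R x \<partial>lebn n)"
    by (intro nn_integral_mono) (auto simp: indicator_def)
  also have "(\<integral>\<^sup>+x. ennreal l * indicator ?R x \<partial>lebn n) = ennreal (2 * ?v)"
    using less.prems V l0 by (simp add: nn_integral_cmult_indicator emeasure_cell l_def flip: ennreal_mult)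
  finally have 1: "(\<integral>\<^sup>+x\<in>?R. dmax N a s x \<partial>lebn n) \<le> ennreal (2 * ?v + 2 * C * measure \<nu> S)"
    using C by (simp add: S_int S_meas S_fin ennreal_mult ennreal_plus)
  show ?case
  \<comment> \<open>A cell of mass 0 is treated apart: the level \<open>l\<close> is then 0, and the
    weak-type inequality says nothing about the volume of \<open>S\<close>.\<close>
  proof (cases "?v = 0")
    case True
    with Sv have "measure \<nu> S = 0"
      by (intro antisym) auto
    with 1 True show ?thesis by (simp add: fin)
  next
    case False
    then have v: "0 < ?v" by (simp add: less_le)
    have "ennreal l * emeasure (lebn n) S \<le> emeasure \<nu> S"
      using emeasure_dmax_gt_ge[OF less.prems, where l = "ennreal l" and a = a and N = N] by (simp add: S_int S_meas)
    then have "l * measure (lebn n) S \<le> measure \<nu> S"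
      using l0 unfolding S_fin by (simp flip: ennreal_mult)
    with Sv have "l * measure (lebn n) S \<le> ?v"
      by linarith
    moreover have "(2 * measure (lebn n) S) * (?v / ?V) = l * measure (lebn n) S"
      by (simp add: l_def)
    moreover have "?V * (?v / ?V) = ?v"
      using less.prems by simp
    ultimately have "(2 * measure (lebn n) S) * (?v / ?V) \<le> ?V * (?v / ?V)"
      by simp
    then have half: "2 * measure (lebn n) S \<le> ?V"
      using v V by (simp only: mult_le_cancel_right_pos divide_pos_pos)
    have "emeasure (lebn n) (?R - S) = ennreal (?V - measure (lebn n) S)"
      using S less.prems by (simp add: emeasure_Diff S_fin emeasure_cell ennreal_minus)
    moreover have "ennreal ?V \<le> ennreal (2 * (?V - measure (lebn n) S))"
      using half by (intro ennreal_leI) simp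
    moreover have "ennreal (2 * (?V - measure (lebn n) S)) = 2 * ennreal (?V - measure (lebn n) S)"
    proof -
      have "0 \<le> ?V - measure (lebn n) S"
        using half measure_nonneg[of "lebn n" S] by linarith
      then show ?thesis by (subst ennreal_mult) auto
    qed
    ultimately have "emeasure (lebn n) ?R \<le> 2 * emeasure (lebn n) (?R - S)"
      using less.prems by (simp only: emeasure_cell less_imp_le)
    then have "emeasure \<nu> ?R \<le> ennreal C * emeasure \<nu> (?R - S)"
      using less.prems by (intro sub) auto
    also have "emeasure \<nu> (?R - S) = ennreal (?v - measure \<nu> S)"
      using S by (simp add: emeasure_Diff S_fin fin ennreal_minus)
    finally have "?v \<le> C * (?v - measure \<nu> S)"
      using C Sv by (simp add: fin flip: ennreal_mult)
    then have "2 * ?v + 2 * C * measure \<nu> S \<le> 2 * C * ?v"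
      by (simp add: algebra_simps)
    then have "ennreal (2 * ?v + 2 * C * measure \<nu> S) \<le> ennreal (2 * C * ?v)"
      by (rule ennreal_leI)
    with 1 show ?thesis
      using C by (simp add: fin ennreal_mult)
  qed
qed

lemma ex_descendant:
  assumes "0 < s" "x \<in> cell n a s"
  shows "\<exists>b. x \<in> cell n b (s / 2 ^ N) \<and> avg b (s / 2 ^ N) \<le> dmax N a s x"
  using assms
proof (induction N arbitrary: a s)
  case (Suc N)
  obtain e where e: "e \<in> halves n" "x \<in> cell n (corner a s e) (s / 2)"
    using ex_half_cell[OF Suc.prems] by blast
  from Suc.IH[of "s / 2" "corner a s e"] Suc.prems(1) e(2)
  obtain b where "x \<in> cell n b (s / 2 / 2 ^ N)" "avg b (s / 2 / 2 ^ N) \<le> dmax N (corner a s e) (s / 2) x"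
    by auto
  then show ?case
    using dmax_Suc[OF Suc.prems(1) e] by (intro exI[of _ b]) (simp add: le_max_iff_disj)
qed auto

end

subsection \<open>Weights and the \<open>A\<^sub>p\<close> condition\<close>

lemma sets_weight_measure [simp]: "sets (weight_measure n w) = sets (lebn n)"
  by (simp add: weight_measure_def)

lemma weight_measurable: "weight n w \<Longrightarrow> w \<in> borel_measurable (lebn n)"
  by (simp add: weight_def locally_integrable_def)

lemma emeasure_weight_measure:
  assumes "weight n w" "A \<in> sets (lebn n)"
  shows "emeasure (weight_measure n w) A = (\<integral>\<^sup>+x\<in>A. ennreal (w x) \<partial>lebn n)"
  using weight_measurable[OF assms(1)] assms(2) by (simp add: weight_measure_def emeasure_density)

lemma emeasure_weight_measure_abs:
  assumes "weight n w" "A \<in> sets (lebn n)"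
  shows "(\<integral>\<^sup>+x\<in>A. ennreal \<bar>w x\<bar> \<partial>lebn n) = emeasure (weight_measure n w) A"
proof -
  have "AE x in lebn n. 0 < w x"
    using assms by (simp add: weight_def)
  then have "AE x in lebn n. ennreal \<bar>w x\<bar> * indicator A x = ennreal (w x) * indicator A x"
    by eventually_elim simp
  then show ?thesis
    unfolding emeasure_weight_measure[OF assms] by (rule nn_integral_cong_AE)
qed

text \<open>Closed boxes are compact in the product topology, so local integrability
  applies.\<close>

lemma emeasure_weight_measure_box:
  assumes "weight n w"
  shows "emeasure (weight_measure n w) (\<Pi>\<^sub>E i\<in>{..<n}. {a i..b i}) < \<infinity>"
proof -
  let ?K = "\<Pi>\<^sub>E i\<in>{..<n}. {a i..b i}"
  have K: "?K \<in> sets (lebn n)"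
    by (intro sets_PiE_lebn) auto
  have "compactin (powertop_real {..<n}) ?K"
    by (simp add: compactin_PiE)
  then have "integrable (lebn n) (\<lambda>x. indicator ?K x *\<^sub>R w x)"
    using assms by (simp add: weight_def locally_integrable_def set_integrable_def)
  then have "(\<integral>\<^sup>+x. ennreal (norm (indicator ?K x *\<^sub>R w x)) \<partial>lebn n) < \<infinity>"
    by (simp add: integrable_iff_bounded)
  also have "(\<integral>\<^sup>+x. ennreal (norm (indicator ?K x *\<^sub>R w x)) \<partial>lebn n) = (\<integral>\<^sup>+x\<in>?K. ennreal \<bar>w x\<bar> \<partial>lebn n)"
    by (intro nn_integral_cong) (auto simp: indicator_def)
  finally show ?thesis
    using emeasure_weight_measure_abs[OF assms K] by simp
qed

lemma cell_measure_weight: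
  assumes "weight n w"
  shows "cell_measure n (weight_measure n w)"
proof
  show "emeasure (weight_measure n w) (cell n a s) < \<infinity>" for a s
  proof (rule le_less_trans[OF _ emeasure_weight_measure_box[OF assms]])
    show "emeasure (weight_measure n w) (cell n a s) \<le>
        emeasure (weight_measure n w) (\<Pi>\<^sub>E i\<in>{..<n}. {a i..a i + s})"
      unfolding cell_def by (intro emeasure_mono PiE_mono) (auto intro: sets_PiE_lebn)
  qed
qed simp

lemma cell_subset_cube: "cell n (\<lambda>i. c i - l / 2) l \<subseteq> cube n c l"
proof
  fix x assume x: "x \<in> cell n (\<lambda>i. c i - l / 2) l"
  have "c i - l / 2 \<le> x i \<and> x i \<le> c i + l / 2" if "i < n" for i
  proof -
    have "c i - l / 2 \<le> x i" "x i < c i - l / 2 + l"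
      using x that by (auto simp: mem_cell)
    then show ?thesis by linarith
  qed
  with x show "x \<in> cube n c l"
    by (simp add: mem_cell mem_cube)
qed

text \<open>The cell lies in the closed cube and both have volume \<open>l ^ n\<close>, so they
  differ by a null set. This is the passage between cubes and cells.\<close>

lemma AE_cube_cell:
  assumes "0 \<le> l"
  shows "AE x in lebn n. x \<in> cube n c l \<longleftrightarrow> x \<in> cell n (\<lambda>i. c i - l / 2) l"
proof -
  have "emeasure (lebn n) (cube n c l - cell n (\<lambda>i. c i - l / 2) l) = 0"
    using assms cell_subset_cube[of n c l] by (simp add: emeasure_Diff emeasure_cell emeasure_cube)
  then have "cube n c l - cell n (\<lambda>i. c i - l / 2) l \<in> null_sets (lebn n)"
    by (intro null_setsI) auto
  from AE_not_in[OF this] show ?thesis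
    using cell_subset_cube[of n c l] by (auto elim!: eventually_mono)
qed

lemma emeasure_weight_measure_cube:
  assumes "weight n w" "0 \<le> l"
  shows "emeasure (weight_measure n w) (cube n c l) =
    emeasure (weight_measure n w) (cell n (\<lambda>i. c i - l / 2) l)"
  unfolding emeasure_weight_measure[OF assms(1) cube_in_sets] emeasure_weight_measure[OF assms(1) cell_in_sets]
proof (rule nn_integral_cong_AE)
  show "AE x in lebn n. ennreal (w x) * indicator (cube n c l) x =
      ennreal (w x) * indicator (cell n (\<lambda>i. c i - l / 2) l) x"
    using AE_cube_cell[OF assms(2), of n c] by eventually_elim (simp add: indicator_def)
qed

lemma emeasure_weight_measure_cube_finite:
  assumes "weight n w"
  shows "emeasure (weight_measure n w) (cube n c l) < \<infinity>"
  unfolding cube_def by (rule emeasure_weight_measure_box[OF assms])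

lemma set_nn_integral_AE_pos:
  assumes "f \<in> borel_measurable M" "A \<in> sets M" "emeasure M A \<noteq> 0" "AE x in M. 0 < f x"
  shows "(\<integral>\<^sup>+x\<in>A. f x \<partial>M) \<noteq> 0"
proof
  assume "(\<integral>\<^sup>+x\<in>A. f x \<partial>M) = 0"
  then have "AE x in M. f x * indicator A x = 0"
    using assms by (subst (asm) nn_integral_0_iff_AE) auto
  with assms(4) have "AE x in M. x \<notin> A"
    by eventually_elim (auto simp: indicator_def split: if_splits)
  then have "emeasure M {x \<in> space M. x \<in> A} = 0"
    using assms(2) by (subst (asm) AE_iff_measurable) auto
  moreover have "{x \<in> space M. x \<in> A} = A"
    using sets.sets_into_space[OF assms(2)] by auto
  ultimately show False
    using assms(3) by simp
qed

lemma emeasure_weight_measure_cube_pos: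
  assumes "weight n w" "0 < l"
  shows "emeasure (weight_measure n w) (cube n c l) \<noteq> 0"
  unfolding emeasure_weight_measure[OF assms(1) cube_in_sets]
  using assms weight_measurable[OF assms(1)]
  by (intro set_nn_integral_AE_pos) (auto simp: emeasure_cube weight_def)

text \<open>For \<open>p = 1\<close>, the reciprocal of \<open>w\<close> is bounded on
  \<open>E\<close> by its essential supremum over the cube. For \<open>p > 1\<close>, Markov's
  inequality for the dual weight \<open>w powr r\<close> leaves a part of \<open>E\<close> of
  proportional volume on which \<open>w\<close> is bounded below. Later \<gamma> is
  \<open>1 / 2\<close> for the maximal function and \<open>1 / 3 ^ n\<close> for tripling.\<close>

lemma A_infinity_large_subset:
  assumes w: "weight n w" "w \<in> A_infinity n" and \<gamma>: "0 < \<gamma>"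
  shows "\<exists>C\<ge>0. \<forall>c l E. c \<in> space (lebn n) \<and> 0 < l \<and> E \<in> sets (lebn n) \<and> E \<subseteq> cube n c l \<and>
    ennreal \<gamma> * emeasure (lebn n) (cube n c l) \<le> emeasure (lebn n) E \<longrightarrow>
    emeasure (weight_measure n w) (cube n c l) \<le> ennreal C * emeasure (weight_measure n w) E"
proof -
  let ?\<nu> = "weight_measure n w"
  note [measurable] = weight_measurable[OF w(1)]
  have w_pos: "AE x in lebn n. 0 < w x"
    using w(1) by (simp add: weight_def)
  have mean_w: "mean n (cube n c l) w * ennreal (l ^ n) = emeasure ?\<nu> (cube n c l)" "mean n (cube n c l) w \<noteq> 0"
    if "0 < l" for c l
    unfolding mean_def emeasure_weight_measure_abs[OF w(1) cube_in_sets]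
    using that emeasure_weight_measure_cube_pos[OF w(1)] 
    by (simp_all add: emeasure_cube ennreal_divide_times mult_divide_eq_ennreal)
  obtain p where p: "1 \<le> p" "w \<in> A_class p n"
    using w(2) by (auto simp: A_infinity_def)
  show ?thesis
  proof (cases "p = 1")
    case True
    with p have fin: "A1_const n w < \<infinity>" by (simp add: A_class_def)
    define A where "A = enn2real (A1_const n w)"
    have A: "A1_const n w = ennreal A" "0 \<le> A"
      using fin by (simp_all add: A_def)
    show ?thesis
    proof (intro exI[of _ "A / \<gamma>"] conjI allI impI)
      show "0 \<le> A / \<gamma>" using A \<gamma> by simp
      fix c l E
      assume asm: "c \<in> space (lebn n) \<and> 0 < l \<and> E \<in> sets (lebn n) \<and> E \<subseteq> cube n c l \<and>
        ennreal \<gamma> * emeasure (lebn n) (cube n c l) \<le> emeasure (lebn n) E"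
      let ?Q = "cube n c l"
      define S where "S = esssup (restrict_space (lebn n) ?Q) (\<lambda>x. ennreal (inverse (w x)))"
      have "mean n ?Q w * S \<le> ennreal A"
        unfolding A(1)[symmetric] A1_const_def S_def using asm by (intro SUP_upper) (auto simp: cubes_def)
      have "AE x in restrict_space (lebn n) ?Q. ennreal (inverse (w x)) \<le> S"
        unfolding S_def by (rule esssup_AE)
      then have "AE x in lebn n. x \<in> ?Q \<longrightarrow> ennreal (inverse (w x)) \<le> S"
        by (subst (asm) AE_restrict_space_iff) auto
      with w_pos have "AE x in lebn n. indicator E x \<le> S * (ennreal (w x) * indicator E x)"
      proof eventually_elim
        case (elim x)
        show ?case
        proof (cases "x \<in> E")
          case True
          then have "ennreal (inverse (w x)) * ennreal (w x) \<le> S * ennreal (w x)"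
            using elim asm by (intro mult_right_mono) auto
          then show ?thesis
            using True elim by (simp flip: ennreal_mult)
        qed simp
      qed
      then have "(\<integral>\<^sup>+x. indicator E x \<partial>lebn n) \<le> (\<integral>\<^sup>+x. S * (ennreal (w x) * indicator E x) \<partial>lebn n)"
        by (rule nn_integral_mono_AE)
      also have "\<dots> = S * emeasure ?\<nu> E"
        using asm by (subst nn_integral_cmult) (auto simp: emeasure_weight_measure[OF w(1)])
      finally have "emeasure (lebn n) E \<le> S * emeasure ?\<nu> E"
        using asm by simp
      moreover have "ennreal \<gamma> * ennreal (l ^ n) \<le> emeasure (lebn n) E"
        using asm emeasure_cube[of l n c] by auto
      ultimately have "ennreal \<gamma> * ennreal (l ^ n) \<le> S * emeasure ?\<nu> E"
        by (rule order_trans[rotated])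
      \<comment> \<open>Multiplying by the mean turns the volume into the mass of \<open>?Q\<close>
        on the left and \<open>S\<close> into a quantity below \<open>A\<close> on the
        right.\<close>
      then have "mean n ?Q w * (ennreal \<gamma> * ennreal (l ^ n)) \<le> mean n ?Q w * (S * emeasure ?\<nu> E)"
        by (rule mult_left_mono) simp
      also have "\<dots> = (mean n ?Q w * S) * emeasure ?\<nu> E"
        by (simp only: mult.assoc)
      also have "\<dots> \<le> ennreal A * emeasure ?\<nu> E"
        using \<open>mean n ?Q w * S \<le> ennreal A\<close> by (rule mult_right_mono) simp
      also have "mean n ?Q w * (ennreal \<gamma> * ennreal (l ^ n)) = ennreal \<gamma> * emeasure ?\<nu> ?Q"
        unfolding mean_w(1)[OF conjunct1[OF conjunct2[OF asm]], symmetric] by (simp only: ac_simps)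
      finally have "ennreal (1 / \<gamma>) * (ennreal \<gamma> * emeasure ?\<nu> ?Q) \<le>
          ennreal (1 / \<gamma>) * (ennreal A * emeasure ?\<nu> E)"
        by (rule mult_left_mono) simp
      moreover have "ennreal (1 / \<gamma>) * ennreal \<gamma> = 1" "ennreal (1 / \<gamma>) * ennreal A = ennreal (A / \<gamma>)"
        using \<gamma> A(2) by (simp_all flip: ennreal_mult)
      ultimately show "emeasure ?\<nu> ?Q \<le> ennreal (A / \<gamma>) * emeasure ?\<nu> E"
        by (simp only: mult.assoc[symmetric] mult_1_left)
    qed
  next
    case False
    with p have p1: "1 < p" by simp
    from False p have fin: "Ap_const p n w < \<infinity>" by (simp add: A_class_def)
    define A where "A = enn2real (Ap_const p n w)"
    have A: "Ap_const p n w = ennreal A" "0 \<le> A"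
      using fin by (simp_all add: A_def)
    \<comment> \<open>\<open>r\<close> is \<open>1 - p'\<close>, so the power
      \<open>- (p - 1)\<close> of the dual weight gives back \<open>w\<close>.\<close>
    define r where "r = 1 - p / (p - 1)"
    have r: "r * - (p - 1) = 1"
      using p1 by (simp add: r_def field_simps)
    \<comment> \<open>The power of \<open>2 / \<gamma>\<close> comes from the Markov level
      \<open>t\<close>, the last factor from keeping only half of the guaranteed volume of
      \<open>E\<close>.\<close>
    define C where "C = A * (2 / \<gamma>) powr (p - 1) * (2 / \<gamma>)"
    show ?thesis
    proof (intro exI[of _ C] conjI allI impI)
      show "0 \<le> C" using A \<gamma> by (simp add: C_def)
      fix c l E
      assume asm: "c \<in> space (lebn n) \<and> 0 < l \<and> E \<in> sets (lebn n) \<and> E \<subseteq> cube n c l \<and>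
        ennreal \<gamma> * emeasure (lebn n) (cube n c l) \<le> emeasure (lebn n) E"
      let ?Q = "cube n c l"
      let ?\<sigma> = "\<lambda>x. w x powr r"
      have l: "0 < l" and [measurable]: "E \<in> sets (lebn n)" and E: "E \<subseteq> ?Q"
        using asm by auto
      define V where "V = l ^ n"
      have V: "0 < V" "emeasure (lebn n) ?Q = ennreal V"
        using l by (simp_all add: V_def emeasure_cube)
      have le: "mean n ?Q w * ennpowr (mean n ?Q ?\<sigma>) (p - 1) \<le> ennreal A"
        unfolding A(1)[symmetric] Ap_const_def r_def using asm by (intro SUP_upper) (auto simp: cubes_def)
      \<comment> \<open>An infinite mean of the dual weight would make the product infinite, as the
        mean of \<open>w\<close> is nonzero.\<close>
      have "mean n ?Q ?\<sigma> \<noteq> \<infinity>"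
        using le mean_w(2)[OF l, of c] by (auto simp: ennpowr_def ennreal_mult_top top_unique)
      then obtain m where m: "mean n ?Q ?\<sigma> = ennreal m" "0 \<le> m"
        by (cases "mean n ?Q ?\<sigma>") auto
      have int: "(\<integral>\<^sup>+x\<in>?Q. ennreal (?\<sigma> x) \<partial>lebn n) = ennreal (m * V)"
      proof -
        have "(\<integral>\<^sup>+x\<in>?Q. ennreal (?\<sigma> x) \<partial>lebn n) = mean n ?Q ?\<sigma> * ennreal V"
          using V by (simp add: mean_def ennreal_divide_times mult_divide_eq_ennreal)
        then show ?thesis using m V by (simp add: ennreal_mult)
      qed
      have "(\<integral>\<^sup>+x\<in>?Q. ennreal (?\<sigma> x) \<partial>lebn n) \<noteq> 0"
        using V w_pos by (intro set_nn_integral_AE_pos) (auto elim!: eventually_mono)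
      with int m V have m_pos: "0 < m"
        by (cases "m = 0") auto
      \<comment> \<open>At this level Markov's inequality bounds the exceptional set
        \<open>B\<close> by the fraction \<open>\<gamma> / 2\<close> of the cube, half of what
        \<open>E\<close> is known to occupy.\<close>
      define t where "t = 2 * m / \<gamma>"
      have t: "0 < t" using m_pos \<gamma> by (simp add: t_def)
      define B where "B = {x \<in> space (lebn n). t < ?\<sigma> x} \<inter> ?Q"
      have [measurable]: "B \<in> sets (lebn n)"
        unfolding B_def by measurable
      have fin: "emeasure (lebn n) X = ennreal (measure (lebn n) X)" "measure (lebn n) X \<le> V"
        if "X \<in> sets (lebn n)" "X \<subseteq> ?Q" for X
      proof -
        have *: "emeasure (lebn n) X \<le> ennreal V"
          unfolding V(2)[symmetric] using that by (intro emeasure_mono) auto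
        then have "emeasure (lebn n) X < top"
          by (rule le_less_trans) simp
        then show "emeasure (lebn n) X = ennreal (measure (lebn n) X)"
          by (intro emeasure_eq_ennreal_measure) auto
        with * V show "measure (lebn n) X \<le> V" by simp
      qed
      have Bfin: "emeasure (lebn n) B = ennreal (measure (lebn n) B)"
        and Efin: "emeasure (lebn n) E = ennreal (measure (lebn n) E)"
        and EBfin: "emeasure (lebn n) (E - B) = ennreal (measure (lebn n) (E - B))"
        using E by (auto simp: B_def intro!: fin)
      have "ennreal t * emeasure (lebn n) B = (\<integral>\<^sup>+x. ennreal t * indicator B x \<partial>lebn n)"
        by (simp add: nn_integral_cmult_indicator)
      also have "\<dots> \<le> (\<integral>\<^sup>+x\<in>?Q. ennreal (?\<sigma> x) \<partial>lebn n)"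
        by (intro nn_integral_mono) (auto simp: B_def indicator_def intro!: ennreal_leI)
      finally have "t * measure (lebn n) B \<le> m * V"
        using t m V by (simp add: int Bfin flip: ennreal_mult)
      then have B: "measure (lebn n) B \<le> \<gamma> / 2 * V"
        using \<gamma> m_pos by (simp add: t_def field_simps)
      have "ennreal (\<gamma> * V) \<le> ennreal (measure (lebn n) E)"
        using asm \<gamma> V by (simp add: Efin ennreal_mult)
      then have EV: "\<gamma> * V \<le> measure (lebn n) E"
        by (subst (asm) ennreal_le_iff) auto
      have "emeasure (lebn n) E \<le> emeasure (lebn n) ((E - B) \<union> B)"
        by (intro emeasure_mono) auto
      also have "\<dots> \<le> emeasure (lebn n) (E - B) + emeasure (lebn n) B"
        by (intro emeasure_subadditive) auto
      finally have "measure (lebn n) E \<le> measure (lebn n) (E - B) + measure (lebn n) B"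
        by (simp add: Efin Bfin EBfin flip: ennreal_plus)
      with EV B have EB: "\<gamma> / 2 * V \<le> measure (lebn n) (E - B)"
        by (simp add: algebra_simps)
      have "AE x in lebn n. ennreal (t powr - (p - 1)) * indicator (E - B) x \<le> ennreal (w x) * indicator E x"
        using w_pos
      proof eventually_elim
        case (elim x)
        show ?case
        proof (cases "x \<in> E - B")
          case True
          then have "w x powr r \<le> t"
            using E sets.sets_into_space[OF cube_in_sets[of n c l]] by (auto simp: B_def not_less)
          then have "t powr - (p - 1) \<le> (w x powr r) powr - (p - 1)"
            using p1 elim by (intro powr_mono2') auto
          also have "\<dots> = w x"
            using r elim by (simp only: powr_powr) simp
          finally show ?thesis using True by (simp add: ennreal_leI)
        qed (simp add: indicator_def)
      qed
      then have "(\<integral>\<^sup>+x. ennreal (t powr - (p - 1)) * indicator (E - B) x \<partial>lebn n) \<le> emeasure ?\<nu> E"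
        unfolding emeasure_weight_measure[OF w(1) \<open>E \<in> _\<close>] by (rule nn_integral_mono_AE)
      then have "ennreal (t powr - (p - 1) * measure (lebn n) (E - B)) \<le> emeasure ?\<nu> E"
        by (simp add: nn_integral_cmult_indicator EBfin ennreal_mult)
      moreover have "t powr - (p - 1) * (\<gamma> / 2 * V) \<le> t powr - (p - 1) * measure (lebn n) (E - B)"
        using EB by (intro mult_left_mono) auto
      ultimately have nuE: "ennreal (t powr - (p - 1) * (\<gamma> / 2 * V)) \<le> emeasure ?\<nu> E"
        by (meson ennreal_leI order_trans)
      have fin_nu: "emeasure ?\<nu> ?Q = ennreal (measure ?\<nu> ?Q)"
        using emeasure_weight_measure_cube_finite[OF w(1)]
        by (intro emeasure_eq_ennreal_measure) (simp add: less_top)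
      have mean: "mean n ?Q w = ennreal (measure ?\<nu> ?Q / V)"
        unfolding mean_def emeasure_weight_measure_abs[OF w(1) cube_in_sets] fin_nu V(2)
        using V by (simp add: divide_ennreal)
      have "ennreal (measure ?\<nu> ?Q / V * m powr (p - 1)) = mean n ?Q w * ennpowr (mean n ?Q ?\<sigma>) (p - 1)"
        unfolding mean m(1) using V m by (subst ennreal_mult) (auto simp: ennpowr_def)
      with le have "ennreal (measure ?\<nu> ?Q / V * m powr (p - 1)) \<le> ennreal A"
        by simp
      then have "measure ?\<nu> ?Q / V * m powr (p - 1) \<le> A"
        using A by simp
      then have "measure ?\<nu> ?Q \<le> A * m powr - (p - 1) * V"
      proof -
        have "0 < m powr (p - 1)" using m_pos by simp
        then have "measure ?\<nu> ?Q * m powr (p - 1) \<le> A * V"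
          using \<open>measure ?\<nu> ?Q / V * _ \<le> A\<close> V by (simp add: pos_divide_le_eq)
        then have "measure ?\<nu> ?Q \<le> A * V / m powr (p - 1)"
          using \<open>0 < m powr (p - 1)\<close> by (simp only: pos_le_divide_eq)
        then show ?thesis
          unfolding powr_minus_divide by simp
      qed
      also have "\<dots> = C * (t powr - (p - 1) * (\<gamma> / 2 * V))"
      proof -
        have "t powr - (p - 1) = (2 / \<gamma>) powr - (p - 1) * m powr - (p - 1)"
          using \<gamma> m_pos by (simp add: t_def powr_mult[symmetric])
        moreover have "(2 / \<gamma>) powr (p - 1) * (2 / \<gamma>) powr - (p - 1) = 1"
          using \<gamma> by (simp add: powr_add[symmetric])
        moreover have "2 / \<gamma> * (\<gamma> / 2) = 1" using \<gamma> by simp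
        moreover have "A * X * (2 / \<gamma>) * (Y * Z * (\<gamma> / 2 * V)) = A * Z * V * (X * Y) * (2 / \<gamma> * (\<gamma> / 2))" for X Y Z
          by (simp only: ac_simps)
        ultimately show ?thesis
          unfolding C_def by (simp only: mult_1_right)
      qed
      finally have "emeasure ?\<nu> ?Q \<le> ennreal (C * (t powr - (p - 1) * (\<gamma> / 2 * V)))"
        unfolding fin_nu by (rule ennreal_leI)
      also have "\<dots> = ennreal C * ennreal (t powr - (p - 1) * (\<gamma> / 2 * V))"
        using \<open>0 \<le> C\<close> \<gamma> V by (intro ennreal_mult) auto
      also have "\<dots> \<le> ennreal C * emeasure ?\<nu> E"
        using nuE by (rule mult_left_mono) simp
      finally show "emeasure ?\<nu> ?Q \<le> ennreal C * emeasure ?\<nu> E" .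
    qed
  qed
qed

subsection \<open>Comparison with the maximal function over all cubes\<close>

text \<open>Restricted to \<open>{..<n}\<close> because the centers in \<open>cubes\<close> must be
  extensional.\<close>

definition center :: "nat \<Rightarrow> (nat \<Rightarrow> real) \<Rightarrow> real \<Rightarrow> nat \<Rightarrow> real" where
  "center n b t = (\<lambda>i\<in>{..<n}. b i + t / 2)"

lemma center_in_space: "center n b t \<in> space (lebn n)"
  by (simp add: center_def space_lebn)

lemma cube_center_in_cubes: "0 < t \<Longrightarrow> cube n (center n b t) t \<in> cubes n"
  unfolding cubes_def using center_in_space by blast

lemma cell_center: "cell n (\<lambda>i. center n b t i - t / 2) t = cell n b t"
  by (auto simp: mem_cell center_def)

lemma cell_subset_cube_center: "cell n b t \<subseteq> cube n (center n b t) t"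
  using cell_subset_cube[of n "center n b t" t] by (simp add: cell_center)

text \<open>Every average entering \<open>dmax\<close> is over a cell that contains \<open>x\<close>
  and lies in \<open>Q\<close>. Its closed cube competes in the supremum, and cutting the weight off
  outside \<open>Q\<close> loses none of the mass of the cell.\<close>

lemma dmax_le_maximal:
  assumes w: "weight n w" and "0 < t" "cell n b t \<subseteq> Q" "x \<in> cell n b t"
  shows "cell_measure.dmax n (weight_measure n w) N b t x \<le> maximal n (\<lambda>y. w y * indicator Q y) x"
proof -
  interpret cell_measure n "weight_measure n w"
    by (rule cell_measure_weight[OF w])
  have avg: "avg b t \<le> maximal n (\<lambda>y. w y * indicator Q y) x"
    if "0 < t" "cell n b t \<subseteq> Q" "x \<in> cell n b t" for b t
  proof -
    let ?R = "cube n (center n b t) t"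
    have "emeasure (weight_measure n w) (cell n b t) \<le> (\<integral>\<^sup>+y\<in>?R. ennreal \<bar>w y * indicator Q y\<bar> \<partial>lebn n)"
      unfolding emeasure_weight_measure[OF w cell_in_sets]
    proof (rule nn_integral_mono)
      fix y
      show "ennreal (w y) * indicator (cell n b t) y \<le> ennreal \<bar>w y * indicator Q y\<bar> * indicator ?R y"
        using that(2) cell_subset_cube_center[of n b t]
        by (cases "y \<in> cell n b t") (auto simp: indicator_def intro!: ennreal_leI)
    qed
    then have "avg b t \<le> mean n ?R (\<lambda>y. w y * indicator Q y)"
      using that(1) unfolding avg_def mean_def by (simp add: emeasure_cube divide_right_mono_ennreal)
    also have "\<dots> \<le> maximal n (\<lambda>y. w y * indicator Q y) x"
      unfolding maximal_def
    proof (rule SUP_upper)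
      show "?R \<in> {R \<in> cubes n. x \<in> R}"
        using that(1,3) cell_subset_cube_center[of n b t] by (auto intro: cube_center_in_cubes)
    qed
    finally show ?thesis .
  qed
  show ?thesis
    using assms(2-)
  proof (induction N arbitrary: b t)
    case 0
    then show ?case by (simp add: avg)
  next
    case (Suc N)
    obtain e where e: "e \<in> halves n" "x \<in> cell n (corner b t e) (t / 2)"
      using ex_half_cell[OF Suc.prems(1,3)] by blast
    have "dmax N (corner b t e) (t / 2) x \<le> maximal n (\<lambda>y. w y * indicator Q y) x"
      using Suc.prems half_cell_subset[OF Suc.prems(1) e(1)] e(2) by (intro Suc.IH) auto
    then show ?case
      using avg[OF Suc.prems] by (simp only: dmax_Suc[OF Suc.prems(1) e] max.bounded_iff)
  qed
qed

text \<open>The mass on the intersection of the cube with \<open>Q\<close> is bounded by the mass of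
  either set: \<open>X = Q\<close> serves cubes at least as large as \<open>Q\<close>, the other
  choice smaller ones.\<close>

lemma mean_indicator_le:
  assumes w: "weight n w" and "0 < r"
    and "emeasure (weight_measure n w) X \<le> y * ennreal (r ^ n)" "X = cube n c r \<or> X = Q" "Q \<in> sets (lebn n)"
  shows "mean n (cube n c r) (\<lambda>y. w y * indicator Q y) \<le> y"
proof -
  have X: "X \<in> sets (lebn n)" using assms by auto
  have "(\<integral>\<^sup>+y\<in>cube n c r. ennreal \<bar>w y * indicator Q y\<bar> \<partial>lebn n) \<le> (\<integral>\<^sup>+y\<in>X. ennreal \<bar>w y\<bar> \<partial>lebn n)"
    using assms(4) by (intro nn_integral_mono) (auto simp: indicator_def)
  also have "\<dots> \<le> y * ennreal (r ^ n)"
    using assms(3) by (simp add: emeasure_weight_measure_abs[OF w X])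
  finally show ?thesis
    using assms(2) unfolding mean_def
    by (intro divide_le_posI_ennreal) (auto simp: emeasure_cube mult.commute)
qed

text \<open>Over a cube of side at least \<open>l\<close> the truncated weight has mean at most the
  average of the whole cell. A cube of smaller side \<open>r\<close> lies in the triple of a dyadic
  descendant through \<open>x\<close> of side \<open>t\<close> with
  \<open>r \<le> t \<le> 2 * r\<close>; tripling costs \<open>C\<close> and the change of volume
  \<open>2 ^ n\<close>.\<close>

lemma maximal_le_dmax:
  assumes w: "weight n w" and l: "0 < l" and C: "0 \<le> C"
    and doubling: "\<And>c b t. c \<in> space (lebn n) \<Longrightarrow> 0 < t \<Longrightarrow> cell n b t \<subseteq> cube n c (3 * t) \<Longrightarrow>
      emeasure (weight_measure n w) (cube n c (3 * t)) \<le> ennreal C * emeasure (weight_measure n w) (cell n b t)"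
    and x: "x \<in> cell n (\<lambda>i. c i - l / 2) l"
  shows "maximal n (\<lambda>y. w y * indicator (cube n c l) y) x \<le> ennreal (max 1 (2 ^ n * C)) *
    (SUP N. cell_measure.dmax n (weight_measure n w) N (\<lambda>i. c i - l / 2) l x)"
proof -
  interpret cell_measure n "weight_measure n w"
    by (rule cell_measure_weight[OF w])
  let ?\<nu> = "weight_measure n w" and ?a = "\<lambda>i. c i - l / 2" and ?Q = "cube n c l"
  show ?thesis
    unfolding maximal_def
  proof (rule SUP_least)
    fix R assume "R \<in> {Q \<in> cubes n. x \<in> Q}"
    then obtain d r where R: "R = cube n d r" "0 < r" "x \<in> cube n d r"
      by (auto simp: cubes_def)
    show "mean n R (\<lambda>y. w y * indicator ?Q y) \<le> ennreal (max 1 (2 ^ n * C)) * (SUP N. dmax N ?a l x)"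
    proof (cases "l \<le> r")
      case True
      have "emeasure ?\<nu> ?Q = avg ?a l * ennreal (l ^ n)"
        using l by (simp add: emeasure_weight_measure_cube[OF w] avg_times)
      also have "\<dots> \<le> avg ?a l * ennreal (r ^ n)"
        using True l by (intro mult_left_mono ennreal_leI power_mono) auto
      finally have "mean n R (\<lambda>y. w y * indicator ?Q y) \<le> avg ?a l"
        unfolding R(1) using R(2) by (intro mean_indicator_le[OF w, where X = ?Q]) auto
      also have "avg ?a l = 1 * dmax 0 ?a l x" by simp
      also have "\<dots> \<le> ennreal (max 1 (2 ^ n * C)) * (SUP N. dmax N ?a l x)"
        by (intro mult_mono SUP_upper) (auto simp flip: ennreal_1 intro: ennreal_leI)
      finally show ?thesis .
    next
      case False
      \<comment> \<open>The least generation with side below \<open>r\<close> is not generation 0,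
        and the one before it has side between \<open>r\<close> and \<open>2 * r\<close>.\<close>
      define m where "m = (LEAST m. l / 2 ^ m < r)"
      obtain k where "(1 / 2) ^ k < r / l"
        using real_arch_pow_inv[of "r / l" "1 / 2"] R(2) l by auto
      then have "l / 2 ^ k < r"
        using l by (simp add: power_one_over field_simps)
      then have m: "l / 2 ^ m < r" unfolding m_def by (rule LeastI)
      with False have "m \<noteq> 0" by (intro notI) simp
      then obtain N where N: "m = Suc N" by (cases m) auto
      then have "\<not> l / 2 ^ N < r"
        unfolding m_def by (intro not_less_Least) simp
      define t where "t = l / 2 ^ N"
      have t: "0 < t" "r \<le> t" "t \<le> 2 * r"
        using l m \<open>\<not> l / 2 ^ N < r\<close> by (simp_all add: t_def N field_simps)
      obtain b where b: "x \<in> cell n b t" "avg b t \<le> dmax N ?a l x"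
        using ex_descendant[OF l x, of N] by (auto simp: t_def)
      let ?P = "cube n (center n b t) (3 * t)"
      have sub: "cell n b t \<subseteq> ?P" "R \<subseteq> ?P"
      proof -
        have *: "center n b t i - 3 * t / 2 = b i - t" "center n b t i + 3 * t / 2 = b i + 2 * t" if "i < n" for i
          using that by (simp_all add: center_def)
        show "cell n b t \<subseteq> ?P"
        proof
          fix y assume y: "y \<in> cell n b t"
          have "b i - t \<le> y i \<and> y i \<le> b i + 2 * t" if "i < n" for i
          proof -
            have "b i \<le> y i" "y i < b i + t" using y that by (auto simp: mem_cell)
            then show ?thesis using t(1) by linarith
          qed
          then show "y \<in> ?P" using y * by (simp add: mem_cell mem_cube)
        qed
        show "R \<subseteq> ?P"
        proof
          fix y assume y: "y \<in> R"
          have "b i - t \<le> y i \<and> y i \<le> b i + 2 * t" if "i < n" for i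
          proof -
            have "b i \<le> x i" "x i < b i + t" using b that by (auto simp: mem_cell)
            moreover have "d i - r / 2 \<le> y i" "y i \<le> d i + r / 2" "d i - r / 2 \<le> x i" "x i \<le> d i + r / 2"
              using y R that by (auto simp: mem_cube)
            ultimately show ?thesis using t(2) by linarith
          qed
          then show "y \<in> ?P" using y R * by (simp add: mem_cube)
        qed
      qed
      have "emeasure ?\<nu> (cube n d r) \<le> emeasure ?\<nu> ?P"
        using sub R by (intro emeasure_mono) auto
      also have "\<dots> \<le> ennreal C * emeasure ?\<nu> (cell n b t)"
        using sub t by (intro doubling center_in_space)
      also have "\<dots> = ennreal C * (avg b t * ennreal (t ^ n))"
        using t by (simp add: avg_times)
      also have "\<dots> \<le> ennreal C * (avg b t * ennreal ((2 * r) ^ n))"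
        using t by (intro mult_left_mono ennreal_leI power_mono) auto
      also have "ennreal ((2 * r) ^ n) = ennreal (2 ^ n) * ennreal (r ^ n)"
        using R(2) by (simp add: power_mult_distrib ennreal_mult)
      also have "ennreal C * (avg b t * (ennreal (2 ^ n) * ennreal (r ^ n))) =
          (ennreal (2 ^ n) * ennreal C) * avg b t * ennreal (r ^ n)"
        by (simp only: ac_simps)
      also have "ennreal (2 ^ n) * ennreal C = ennreal (2 ^ n * C)"
        using C by (intro ennreal_mult[symmetric]) auto
      finally have "mean n R (\<lambda>y. w y * indicator ?Q y) \<le> ennreal (2 ^ n * C) * avg b t"
        unfolding R(1) using R(2) by (intro mean_indicator_le[OF w, where X = "cube n d r"]) auto
      also have "\<dots> \<le> ennreal (max 1 (2 ^ n * C)) * (SUP N. dmax N ?a l x)"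
      proof (intro mult_mono ennreal_leI)
        show "avg b t \<le> (SUP N. dmax N ?a l x)"
          using b(2) by (rule SUP_upper2[OF UNIV_I])
      qed auto
      finally show ?thesis .
    qed
  qed
qed

text \<open>The ratio \<open>1 / 2\<close> yields the integral bound for \<open>dmax\<close>,
  uniformly in \<open>N\<close>; the ratio \<open>1 / 3 ^ n\<close> yields tripling, which compares
  \<open>maximal\<close> with the supremum of the \<open>dmax\<close>. Monotone convergence joins
  the two.\<close>

lemma fujii_wilson_finite:
  assumes w: "weight n w" "w \<in> A_infinity n"
  shows "fujii_wilson n w < \<infinity>"
proof -
  interpret cell_measure n "weight_measure n w"
    by (rule cell_measure_weight[OF w(1)])
  let ?\<nu> = "weight_measure n w"
  obtain C1 where C1: "0 \<le> C1" "\<And>c l E. c \<in> space (lebn n) \<Longrightarrow> 0 < l \<Longrightarrow> E \<in> sets (lebn n) \<Longrightarrow> E \<subseteq> cube n c l \<Longrightarrow>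
    ennreal (1 / 2) * emeasure (lebn n) (cube n c l) \<le> emeasure (lebn n) E \<Longrightarrow>
    emeasure ?\<nu> (cube n c l) \<le> ennreal C1 * emeasure ?\<nu> E"
    using A_infinity_large_subset[OF w, of "1 / 2"] by auto
  obtain C2 where C2: "0 \<le> C2" "\<And>c l E. c \<in> space (lebn n) \<Longrightarrow> 0 < l \<Longrightarrow> E \<in> sets (lebn n) \<Longrightarrow> E \<subseteq> cube n c l \<Longrightarrow>
    ennreal (1 / 3 ^ n) * emeasure (lebn n) (cube n c l) \<le> emeasure (lebn n) E \<Longrightarrow>
    emeasure ?\<nu> (cube n c l) \<le> ennreal C2 * emeasure ?\<nu> E"
    using A_infinity_large_subset[OF w, of "1 / 3 ^ n"] by auto
  define D where "D = max 1 (2 ^ n * C2)"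
  have dmax_int: "(\<integral>\<^sup>+x\<in>cell n a s. dmax N a s x \<partial>lebn n) \<le> ennreal (2 * C1) * emeasure ?\<nu> (cell n a s)"
    if "0 < s" for N a s
  proof (rule nn_integral_dmax_le[OF _ C1(1) that])
    fix b t E
    assume t: "0 < t" and E: "E \<in> sets (lebn n)" "E \<subseteq> cell n b t"
      and half: "emeasure (lebn n) (cell n b t) \<le> 2 * emeasure (lebn n) E"
    have "emeasure (lebn n) (cube n (center n b t) t) \<le> 2 * emeasure (lebn n) E"
      using half t by (simp add: emeasure_cube emeasure_cell)
    then have "ennreal (1 / 2) * emeasure (lebn n) (cube n (center n b t) t) \<le>
        ennreal (1 / 2) * (2 * emeasure (lebn n) E)"
      by (rule mult_left_mono) simp
    also have "\<dots> = (ennreal (1 / 2) * ennreal 2) * emeasure (lebn n) E"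
      by (simp add: mult.assoc)
    also have "ennreal (1 / 2) * ennreal 2 = 1"
      by (subst ennreal_mult[symmetric]) auto
    finally have "emeasure ?\<nu> (cube n (center n b t) t) \<le> ennreal C1 * emeasure ?\<nu> E"
      using E cell_subset_cube_center[of n b t] t by (intro C1(2) center_in_space) auto
    then show "emeasure ?\<nu> (cell n b t) \<le> ennreal C1 * emeasure ?\<nu> E"
      using t by (simp add: emeasure_weight_measure_cube[OF w(1)] cell_center)
  qed
  have doubling: "emeasure ?\<nu> (cube n c (3 * t)) \<le> ennreal C2 * emeasure ?\<nu> (cell n b t)"
    if "c \<in> space (lebn n)" "0 < t" "cell n b t \<subseteq> cube n c (3 * t)" for c b t
  proof (rule C2(2)[OF that(1) _ cell_in_sets that(3)])
    show "ennreal (1 / 3 ^ n) * emeasure (lebn n) (cube n c (3 * t)) \<le> emeasure (lebn n) (cell n b t)"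
      using that(2) by (simp add: emeasure_cube emeasure_cell power_mult_distrib flip: ennreal_mult)
  qed (use that in simp)
  have "fujii_wilson n w \<le> ennreal D * ennreal (2 * C1)"
    unfolding fujii_wilson_def
  proof (rule SUP_least)
    fix Q assume "Q \<in> cubes n"
    then obtain c l where Q: "Q = cube n c l" "0 < l"
      by (auto simp: cubes_def)
    let ?a = "\<lambda>i. c i - l / 2"
    let ?M = "maximal n (\<lambda>y. w y * indicator Q y)"
    have "AE x in lebn n. ?M x * indicator Q x \<le>
        ennreal D * (SUP N. dmax N ?a l x * indicator (cell n ?a l) x)"
      using AE_cube_cell[OF less_imp_le[OF Q(2)], of n c]
    proof eventually_elim
      case (elim x)
      show ?case
      proof (cases "x \<in> cell n ?a l")
        case True
        have "?M x \<le> ennreal D * (SUP N. dmax N ?a l x)"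
          unfolding Q(1) D_def using w(1) Q(2) C2(1) doubling True by (rule maximal_le_dmax)
        then show ?thesis using True elim Q by simp
      qed (use elim Q in simp)
    qed
    then have "(\<integral>\<^sup>+x\<in>Q. ?M x \<partial>lebn n) \<le>
        (\<integral>\<^sup>+x. ennreal D * (SUP N. dmax N ?a l x * indicator (cell n ?a l) x) \<partial>lebn n)"
      by (rule nn_integral_mono_AE)
    also have "\<dots> = ennreal D * (\<integral>\<^sup>+x. (SUP N. dmax N ?a l x * indicator (cell n ?a l) x) \<partial>lebn n)"
      by (intro nn_integral_cmult) measurable
    also have "(\<integral>\<^sup>+x. (SUP N. dmax N ?a l x * indicator (cell n ?a l) x) \<partial>lebn n) =
        (SUP N. \<integral>\<^sup>+x\<in>cell n ?a l. dmax N ?a l x \<partial>lebn n)"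
    proof (rule nn_integral_monotone_convergence_SUP)
      show "incseq (\<lambda>N x. dmax N ?a l x * indicator (cell n ?a l) x)"
        unfolding incseq_Suc_iff le_fun_def using dmax_mono by (intro allI mult_right_mono) auto
    qed measurable
    also have "ennreal D * \<dots> \<le> ennreal D * (ennreal (2 * C1) * emeasure ?\<nu> Q)"
      using dmax_int[OF Q(2)] Q by (intro mult_left_mono SUP_least) (auto simp: emeasure_weight_measure_cube[OF w(1)])
    finally have le: "(\<integral>\<^sup>+x\<in>Q. ?M x \<partial>lebn n) \<le> emeasure ?\<nu> Q * (ennreal D * ennreal (2 * C1))"
      by (simp only: ac_simps)
    have "0 < emeasure ?\<nu> Q"
      using emeasure_weight_measure_cube_pos[OF w(1) Q(2)] Q by (simp add: zero_less_iff_neq_zero)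
    from this le show "(\<integral>\<^sup>+x\<in>Q. ?M x \<partial>lebn n) / emeasure ?\<nu> Q \<le> ennreal D * ennreal (2 * C1)"
      by (rule divide_le_posI_ennreal)
  qed
  also have "\<dots> < \<infinity>"
    by (simp add: ennreal_mult_less_top)
  finally show ?thesis .
qed

text \<open>Pointwise \<open>dmax\<close> is below the maximal function of the weight cut off to the
  closed cube. This supplies the hypothesis \<open>bound\<close> of the decay and doubling
  lemmas.\<close>

lemma nn_integral_dmax_le_fujii_wilson:
  assumes w: "weight n w" and t: "0 < t"
  shows "(\<integral>\<^sup>+x\<in>cell n b t. cell_measure.dmax n (weight_measure n w) N b t x \<partial>lebn n) \<le>
    fujii_wilson n w * emeasure (weight_measure n w) (cell n b t)"
proof -
  interpret cell_measure n "weight_measure n w"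
    by (rule cell_measure_weight[OF w])
  let ?\<nu> = "weight_measure n w" and ?Q = "cube n (center n b t) t"
  let ?I = "\<integral>\<^sup>+x\<in>?Q. maximal n (\<lambda>y. w y * indicator ?Q y) x \<partial>lebn n"
  have "(\<integral>\<^sup>+x\<in>cell n b t. dmax N b t x \<partial>lebn n) \<le> ?I"
  proof (rule nn_integral_mono)
    fix x
    show "dmax N b t x * indicator (cell n b t) x \<le> maximal n (\<lambda>y. w y * indicator ?Q y) x * indicator ?Q x"
      using dmax_le_maximal[OF w t cell_subset_cube_center] cell_subset_cube_center[of n b t]
      by (cases "x \<in> cell n b t") auto
  qed
  \<comment> \<open>The quotient cancels because the mass of a cube is neither zero nor
    infinite.\<close>
  also have "?I = ?I / emeasure ?\<nu> ?Q * emeasure ?\<nu> ?Q"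
    using emeasure_weight_measure_cube_pos[OF w t] emeasure_weight_measure_cube_finite[OF w]
    by (simp add: ennreal_divide_times mult_divide_eq_ennreal less_top)
  also have "\<dots> \<le> fujii_wilson n w * emeasure ?\<nu> ?Q"
    unfolding fujii_wilson_def using t
    by (intro mult_right_mono SUP_upper cube_center_in_cubes) auto
  finally show ?thesis
    using t by (simp add: emeasure_weight_measure_cube[OF w] cell_center)
qed

text \<open>For \<open>N = 0\<close> the integral of \<open>dmax\<close> is the mass of the cell
  itself; the preceding inequality on the unit cell is divided by that mass.\<close>

lemma fujii_wilson_ge_1:
  assumes w: "weight n w"
  shows "1 \<le> fujii_wilson n w"
proof -
  interpret cell_measure n "weight_measure n w"
    by (rule cell_measure_weight[OF w])
  let ?c = "cell n (\<lambda>_. 0) 1" and ?\<nu> = "weight_measure n w"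
  have "emeasure ?\<nu> ?c = (\<integral>\<^sup>+x\<in>?c. dmax 0 (\<lambda>_. 0) 1 x \<partial>lebn n)"
    using avg_times[of 1 "\<lambda>_. 0"] by (simp add: nn_integral_cmult_indicator emeasure_cell)
  also have "\<dots> \<le> fujii_wilson n w * emeasure ?\<nu> ?c"
    by (rule nn_integral_dmax_le_fujii_wilson[OF w]) simp
  finally have "emeasure ?\<nu> ?c / emeasure ?\<nu> ?c \<le> fujii_wilson n w * emeasure ?\<nu> ?c / emeasure ?\<nu> ?c"
    by (rule divide_right_mono_ennreal)
  moreover have "emeasure ?\<nu> ?c \<noteq> 0"
    using emeasure_weight_measure_cube_pos[OF w, of 1 "center n (\<lambda>_. 0) 1"]
      emeasure_weight_measure_cube[OF w, of 1 "center n (\<lambda>_. 0) 1"] cell_center[of n "\<lambda>_. 0" 1] by simp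
  moreover have "emeasure ?\<nu> ?c \<noteq> top"
    using finite_cell[of "\<lambda>_. 0" 1] by simp
  ultimately show ?thesis
    by (simp add: mult_divide_eq_ennreal ennreal_divide_self less_top[symmetric])
qed

theorem theorem2p5:
  shows "\<exists>\<kappa>::real. \<kappa> > 0 \<and>
    (\<forall>n::nat. n \<ge> 1 \<longrightarrow>
      (\<forall>w :: (nat \<Rightarrow> real) \<Rightarrow> real. weight n w \<and> w \<in> A_infinity n \<longrightarrow>
        (\<exists>D::real.
          (\<forall>c l. c \<in> space (lebn n) \<and> 0 < l \<longrightarrow>
             emeasure (weight_measure n w) (cube n c (2 * l))
               \<le> ennreal D * emeasure (weight_measure n w) (cube n c l)) \<and>
          D \<le> exp (\<kappa> * real n *
                 (4 * enn2real (fujii_wilson n w))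
                   powr (1 + 2 ^ (n + 1) * (enn2real (fujii_wilson n w) - 1))))))"
proof (rule exI[of _ 32], intro conjI allI impI)
  fix n :: nat and w :: "(nat \<Rightarrow> real) \<Rightarrow> real"
  assume n: "1 \<le> n" and "weight n w \<and> w \<in> A_infinity n"
  then have w: "weight n w" "w \<in> A_infinity n" by auto
  interpret cell_measure n "weight_measure n w"
    by (rule cell_measure_weight[OF w(1)])
  define W where "W = enn2real (fujii_wilson n w)"
  \<comment> \<open>Finiteness is essential here, since \<open>enn2real\<close> sends infinity to
    0.\<close>
  have W_eq: "fujii_wilson n w = ennreal W"
    using fujii_wilson_finite[OF w] by (simp add: W_def)
  have "1 \<le> ennreal W"
    using fujii_wilson_ge_1[OF w(1)] by (simp add: W_eq)
  then have W: "1 \<le> W" by simp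
  obtain k N where kN: "8 * real n * 2 ^ k \<le> 2 ^ N" "2 * (W - 1) \<le> (1 + 1 / (2 * (2 ^ n * W - 1))) ^ k"
    and D: "(4::real) ^ (2 ^ (N - 1)) \<le> exp (32 * real n * (4 * W) powr (1 + 2 ^ (n + 1) * (W - 1)))"
    using ex_iteration_parameters[OF W n] by blast
  show "\<exists>D::real. (\<forall>c l. c \<in> space (lebn n) \<and> 0 < l \<longrightarrow>
      emeasure (weight_measure n w) (cube n c (2 * l)) \<le> ennreal D * emeasure (weight_measure n w) (cube n c l)) \<and>
      D \<le> exp (32 * real n * (4 * enn2real (fujii_wilson n w)) powr
        (1 + 2 ^ (n + 1) * (enn2real (fujii_wilson n w) - 1)))"
  \<comment> \<open>One factor 4 for each of the \<open>2 ^ (N - 1)\<close> peelings; the estimate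
    \<open>D\<close> is what fixes \<kappa> as 32.\<close>
  proof (intro exI[of _ "4 ^ (2 ^ (N - 1))"] conjI allI impI)
    fix c :: "nat \<Rightarrow> real" and l :: real
    assume "c \<in> space (lebn n) \<and> 0 < l"
    then have l: "0 < l" by simp
    have "emeasure (weight_measure n w) (cell n (\<lambda>i. c i - 2 * l / 2) (2 * l)) \<le>
        4 ^ 2 ^ (N - 1) * emeasure (weight_measure n w) (cell n (\<lambda>i. c i - l / 2) l)"
      using nn_integral_dmax_le_fujii_wilson[OF w(1)] unfolding W_eq
      by (intro emeasure_cell_doubling[OF _ W n l kN])
    moreover have "ennreal (4 ^ 2 ^ (N - 1)) = 4 ^ 2 ^ (N - 1)"
      by (simp flip: ennreal_power)
    ultimately show "emeasure (weight_measure n w) (cube n c (2 * l)) \<le>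
        ennreal (4 ^ 2 ^ (N - 1)) * emeasure (weight_measure n w) (cube n c l)"
      using l by (simp only: emeasure_weight_measure_cube[OF w(1)] less_imp_le mult_nonneg_nonneg zero_le_numeral)
  qed (use D in \<open>simp only: W_def\<close>)
qed simp

end
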